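(* For every $\varepsilon>0$, every non-superreflexive Banach space $X$, and all $n,k\in\mathbb{N}$ with $k\ge 2$, there exists a bilipschitz embedding of the diamond graph $D_{n,k}$ (of branching $k$, with its shortest path distance) into $X$ with distortion at most $8+\varepsilon$.
   Context: Diamond graphs of branching $k$: for any integer $k\ge 2$, $D_{0,k}$ is the graph consisting of two vertices joined by one edge. For $n\in\mathbb{N}$, if $D_{n-1,k}$ is already defined, $D_{n,k}$ is the graph obtained from $D_{n-1,k}$ by replacing each edge $uv$ of $D_{n-1,k}$ by a set of $k$ independent (i.e. internally vertex-disjoint) paths of length $2$ joining $u$ and $v$. The graph $D_{n,k}$ is endowed with the shortest path distance $d_{D_{n,k}}$, normalized so that each edge has length $2^{-n}$. Distortion: a map $f:(M,d_M)\to X$ from a metric space to a Banach space is a bilipschitz embedding with distortion at most $D$ if there is $r>0$ such that $r\,d_M(u,v)\le\|f(u)-f(v)\|\le D\,r\,d_M(u,v)$ for all $u,v\in M$. (This notion does not depend on the scaling of the metric.) A Banach space $X$ is superreflexive if every Banach space finitely representable in $X$ is reflexive. *)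

theory Defs
  imports "HOL-Analysis.Analysis"
begin

text \<open>Diamond graphs. Edges are stored as ordered pairs, oriented from one pole to the other, so that
  each undirected edge is listed exactly once. The vertex \<open>Mid u v i\<close> is the midpoint of the
  \<open>i\<close>-th path of length 2 that replaces the edge \<open>(u, v)\<close>.\<close>

datatype diamond_vertex =
    Bottom
  | Top
  | Mid diamond_vertex diamond_vertex nat

fun diamond_edges :: "nat \<Rightarrow> nat \<Rightarrow> (diamond_vertex \<times> diamond_vertex) set" where
  "diamond_edges 0 k = {(Bottom, Top)}"
| "diamond_edges (Suc n) k =
     (\<Union>(u, v)\<in>diamond_edges n k. \<Union>i<k. {(u, Mid u v i), (Mid u v i, v)})"

text \<open>No diamond graph has an isolated vertex, so the vertices are the endpoints of the edges.\<close>

definition diamond_verts :: "nat \<Rightarrow> nat \<Rightarrow> diamond_vertex set" where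
  "diamond_verts n k = Field (diamond_edges n k)"

definition diamond_adj :: "nat \<Rightarrow> nat \<Rightarrow> (diamond_vertex \<times> diamond_vertex) set" where
  "diamond_adj n k = diamond_edges n k \<union> (diamond_edges n k)\<inverse>"

text \<open>A pair \<open>(u, v)\<close> lies in \<open>diamond_adj n k ^^ m\<close> iff there is a walk with \<open>m\<close> edges
  from \<open>u\<close> to \<open>v\<close>; every edge has length \<open>1 / 2 ^ n\<close>.\<close>

definition diamond_dist :: "nat \<Rightarrow> nat \<Rightarrow> diamond_vertex \<Rightarrow> diamond_vertex \<Rightarrow> real" where
  "diamond_dist n k u v = real (LEAST m. (u, v) \<in> diamond_adj n k ^^ m) / 2 ^ n"

definition bilipschitz_embedding ::
    "'m set \<Rightarrow> ('m \<Rightarrow> 'm \<Rightarrow> real) \<Rightarrow> real \<Rightarrow> ('m \<Rightarrow> 'x::real_normed_vector) \<Rightarrow> bool" where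
  "bilipschitz_embedding M d D f \<longleftrightarrow>
     (\<exists>r>0. \<forall>u\<in>M. \<forall>v\<in>M.
        r * d u v \<le> norm (f u - f v) \<and> norm (f u - f v) \<le> D * r * d u v)"

definition canonical_embedding :: "'y::real_normed_vector \<Rightarrow> ('y \<Rightarrow>\<^sub>L real) \<Rightarrow>\<^sub>L real" where
  "canonical_embedding y = Blinfun (\<lambda>f. blinfun_apply f y)"

lemma canonical_embedding_apply [simp]:
  "blinfun_apply (canonical_embedding y) f = blinfun_apply f y"
  unfolding canonical_embedding_def
  by (simp add: bounded_linear_Blinfun_apply blinfun.bounded_linear_left)

definition reflexive_space :: "'y::banach itself \<Rightarrow> bool" where
  "reflexive_space _ \<longleftrightarrow> surj (canonical_embedding :: 'y \<Rightarrow> ('y \<Rightarrow>\<^sub>L real) \<Rightarrow>\<^sub>L real)"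

text \<open>\<open>finitely_representable TYPE('y) TYPE('x)\<close>: the space \<open>'y\<close> is finitely representable in
  \<open>'x\<close>. The finite-dimensional subspaces of \<open>'y\<close> are the spans of finite sets. With
  \<open>F = span B\<close>, the map \<open>T\<close> restricts to an isomorphism of \<open>F\<close> onto the subspace \<open>T ` F\<close>, the
  constants \<open>a\<close> and \<open>b\<close> bounding the norms of that restriction and of its inverse. Outside \<open>F\<close>
  the map \<open>T\<close> is irrelevant: any linear map on \<open>F\<close> extends to a (possibly unbounded) linear map
  on all of \<open>'y\<close>.\<close>

definition finitely_representable :: "'y::banach itself \<Rightarrow> 'x::banach itself \<Rightarrow> bool" where
  "finitely_representable _ _ \<longleftrightarrow>
     (\<forall>B::'y set. finite B \<longrightarrow>
        (\<forall>\<epsilon>>0. \<exists>(T::'y \<Rightarrow> 'x) a b. linear T \<and> 0 < a \<and> 0 < b \<and> a * b \<le> 1 + \<epsilon> \<and>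
           (\<forall>y\<in>span B. norm (T y) \<le> a * norm y \<and> norm y \<le> b * norm (T y))))"

text \<open>A formula cannot quantify over types, so superreflexivity of \<open>'x\<close> is split up by the
  test space \<open>'y\<close>: \<open>'x\<close> is superreflexive iff \<open>superreflexive_wrt TYPE('y) TYPE('x)\<close> holds for
  all Banach spaces \<open>'y\<close>. Hence a theorem that assumes
  \<open>\<not> superreflexive_wrt TYPE('y) TYPE('x)\<close> with \<open>'y\<close> a type variable occurring nowhere else is
  a theorem about all \<open>'x\<close> that are not superreflexive, \<open>'y\<close> being a witness for this.\<close>

definition superreflexive_wrt :: "'y::banach itself \<Rightarrow> 'x::banach itself \<Rightarrow> bool" where
  "superreflexive_wrt Y X \<longleftrightarrow> (finitely_representable Y X \<longrightarrow> reflexive_space Y)"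

end

theory Submission imports Defs begin

text \<open>Let \<open>F\<close> be a point of the bidual that does not come from the space, and \<open>U\<close> an ultrafilter on a
  ball converging to \<open>F\<close> in the weak* topology. The iterated limits
  \<open>lim x\<^sub>1\<rightarrow>U. \<dots> lim x\<^sub>r\<rightarrow>U. norm (a\<^sub>1 x\<^sub>1 + \<dots> + a\<^sub>r x\<^sub>r)\<close> form a seminorm of coefficient lists that ignores
  zeros, and averaging shifts shows that, after passing to long averages, replacing consecutive
  coefficients by their sum does not increase it (the equal-signs-additive norms of Brunel and
  Sucheston). Alternating patterns \<open>1, -1, 1, -1, \<dots>\<close> stay bounded away from 0 because \<open>F\<close> has
  positive distance from the space.

  Take \<open>2 ^ k\<close> pairs of a positive and a negative block of \<open>2 ^ n\<close> places, one pair for each vector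
  of \<open>k\<close> bits. A vertex is mapped to the signed indicator of a set of places in each block:
  the poles get nothing and everything, and the \<open>i\<close>-th midpoint of an edge gets the left or the right
  half of what the edge adds, depending on the \<open>i\<close>-th bit. The two ends of an edge differ by one place
  per block, that is, by an alternating pattern. If two vertices branch off at midpoints
  \<open>i \<noteq> j\<close>, then for the half of the bit vectors where bits \<open>i\<close> and \<open>j\<close> differ, the two branches
  occupy different halves, and merging leaves an alternating pattern of height at least half the
  distance. This yields distortion \<open>4 + \<epsilon>\<close> in the space, and the finitely many norms involved
  are realised by actual points and then transported by finite representability.\<close>

section \<open>Ultrafilters converging to points of the bidual\<close>

text \<open>Zorn's lemma yields a minimal proper filter below \<open>F\<close>. It decides every
  \<open>P\<close>, because its meet with the principal filter of \<open>P\<close> is either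
  \<open>bot\<close> or the filter itself.\<close>

lemma ex_ultrafilter_le:
  fixes F :: "'a filter"
  assumes "F \<noteq> bot"
  obtains U where "U \<noteq> bot" "U \<le> F" "\<And>P. eventually P U \<or> eventually (\<lambda>x. \<not> P x) U"
proof -
  define A where "A = {G. G \<noteq> bot \<and> G \<le> F}"
  have "\<exists>U\<in>A. \<forall>G\<in>A. U \<ge> G \<longrightarrow> G = U"
  proof (rule predicate_Zorn)
    show "partial_order_on A (relation_of (\<ge>) A)"
      by (rule partial_order_on_relation_ofI) auto
  next
    fix C assume C: "C \<in> Chains (relation_of (\<ge>) A)"
    have CA: "C \<subseteq> A" and tot: "\<And>a b. a \<in> C \<Longrightarrow> b \<in> C \<Longrightarrow> a \<le> b \<or> b \<le> a"
      using C by (auto simp: Chains_def relation_of_def)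
    show "\<exists>u\<in>A. \<forall>a\<in>C. a \<ge> u"
    proof (cases "C = {}")
      case True
      then show ?thesis using assms by (auto simp: A_def)
    next
      case False
      \<comment> \<open>In a chain every finite nonempty infimum is a member, hence proper, and so
        the infimum of the whole chain is proper.\<close>
      have fin: "Inf X \<in> C" if "finite X" "X \<noteq> {}" "X \<subseteq> C" for X
        using that
      proof (induction rule: finite_ne_induct)
        case (insert x X)
        then show ?case using tot[of x "Inf X"] by (auto simp: inf_absorb1 inf_absorb2)
      qed auto
      have "Inf C \<noteq> bot"
      proof (rule Inf_filter_not_bot)
        fix X assume "X \<subseteq> C" "finite X"
        moreover have "top \<noteq> (bot :: 'a filter)"
          using assms top_greatest[of F] le_bot by metis
        ultimately show "Inf X \<noteq> bot"
          using fin[of X] CA assms by (cases "X = {}") (auto simp: A_def)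
      qed
      moreover have "Inf C \<le> F"
        using False CA by (auto simp: A_def intro: Inf_lower2)
      ultimately show ?thesis by (intro bexI[of _ "Inf C"]) (auto simp: A_def Inf_lower)
    qed
  qed
  then obtain U where U: "U \<noteq> bot" "U \<le> F" and max: "\<And>G. G \<noteq> bot \<Longrightarrow> G \<le> U \<Longrightarrow> G = U"
    unfolding A_def by (metis (mono_tags, lifting) dual_order.trans mem_Collect_eq)
  have "eventually P U \<or> eventually (\<lambda>x. \<not> P x) U" for P
  proof (cases "inf U (principal {x. P x}) = bot")
    case True
    then show ?thesis
      by (simp add: trivial_limit_def eventually_inf_principal)
  next
    case False
    then have "inf U (principal {x. P x}) = U" by (intro max) auto
    moreover have "eventually P (inf U (principal {x. P x}))"
      by (simp add: eventually_inf_principal)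
    ultimately show ?thesis by simp
  qed
  with U that show ?thesis by blast
qed

text \<open>Compactness gives a cluster point \<open>l\<close> of the image filter. An ultrafilter
  not eventually inside a neighbourhood of \<open>l\<close> is eventually outside it, which a
  cluster point excludes.\<close>

lemma ultrafilter_tendsto_compact:
  fixes g :: "'a \<Rightarrow> 'b::t2_space"
  assumes "U \<noteq> bot" and ultra: "\<And>P. eventually P U \<or> eventually (\<lambda>x. \<not> P x) U"
    and "compact K" and "eventually (\<lambda>x. g x \<in> K) U"
  obtains l where "(g \<longlongrightarrow> l) U"
proof -
  have "filtermap g U \<noteq> bot"
    using assms(1) by (simp add: filtermap_bot_iff)
  moreover have "eventually (\<lambda>y. y \<in> K) (filtermap g U)"
    using assms(4) by (simp add: eventually_filtermap)
  ultimately obtain l where l: "inf (nhds l) (filtermap g U) \<noteq> bot"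
    using \<open>compact K\<close> unfolding compact_filter by blast
  have "(g \<longlongrightarrow> l) U"
  proof (rule topological_tendstoI)
    fix S assume S: "open S" "l \<in> S"
    show "eventually (\<lambda>x. g x \<in> S) U"
    proof (rule ccontr)
      assume "\<not> ?thesis"
      then have "eventually (\<lambda>y. y \<notin> S) (filtermap g U)"
        using ultra[of "\<lambda>x. g x \<in> S"] by (simp add: eventually_filtermap)
      moreover have "eventually (\<lambda>y. y \<in> S) (nhds l)"
        using S by (rule eventually_nhds_in_open)
      ultimately have "eventually (\<lambda>y. False) (inf (nhds l) (filtermap g U))"
        unfolding eventually_inf by blast
      then show False using l by (simp add: trivial_limit_def)
    qed
  qed
  then show ?thesis by (rule that)
qed

text \<open>Helly's lemma. At an almost minimal point \<open>x\<close> of the sum of squares, convexity forces the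
  functional \<open>\<Sum>\<^sub>f (f x - F f) *\<^sub>R f\<close> to be almost minimal at \<open>x\<close> on the ball, which bounds the
  sum of squares because \<open>F\<close> is bounded by the radius of the ball.\<close>

lemma Helly_approximation:
  fixes F :: "('y::real_normed_vector \<Rightarrow>\<^sub>L real) \<Rightarrow>\<^sub>L real"
  assumes "finite \<Phi>" and "\<delta> > 0"
  shows "\<exists>x. norm x \<le> norm F \<and> (\<forall>f\<in>\<Phi>. \<bar>blinfun_apply f x - blinfun_apply F f\<bar> < \<delta>)"
proof -
  define B where "B = {x::'y. norm x \<le> norm F}"
  define Q where "Q x = (\<Sum>f\<in>\<Phi>. (blinfun_apply f x - F f)\<^sup>2)" for x
  define m where "m = Inf (Q ` B)"
  have Q0: "Q x \<ge> 0" for x unfolding Q_def by (simp add: sum_nonneg)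
  have bdd: "bdd_below (Q ` B)" using Q0 by (auto intro!: bdd_belowI[of _ 0])
  have B0: "0 \<in> B" by (simp add: B_def)
  have m_le: "m \<le> Q x" if "x \<in> B" for x
    unfolding m_def using bdd that by (simp add: cINF_lower)
  have "m \<le> 0"
  proof (rule ccontr)
    assume "\<not> m \<le> 0"
    then have m: "m > 0" by simp
    define C where "C = (\<Sum>f\<in>\<Phi>. (2 * norm F * norm f)\<^sup>2)"
    have C0: "C \<ge> 0" unfolding C_def by (simp add: sum_nonneg)
    \<comment> \<open>For this step length the quadratic term of \<open>Q\<close> along a segment in
      the ball stays below \<open>t * m\<close>.\<close>
    define t where "t = min 1 (m / (2 * (C + 1)))"
    have t: "0 < t" "t \<le> 1" "t * C < m"
    proof -
      show "0 < t" "t \<le> 1" using m C0 by (auto simp: t_def)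
      have "t * C \<le> m / (2 * (C + 1)) * C"
        using C0 by (intro mult_right_mono) (auto simp: t_def)
      also have "\<dots> < m" using m C0 by (simp add: field_simps add_nonneg_pos)
      finally show "t * C < m" .
    qed
    obtain x where x: "x \<in> B" "Q x < m + t * m / 2"
    proof -
      have "m + t * m / 2 > Inf (Q ` B)" using m t by (simp add: m_def[symmetric])
      with cInf_lessD[of "Q ` B"] B0 show ?thesis using that by blast
    qed
    define g where "g = (\<Sum>f\<in>\<Phi>. (blinfun_apply f x - F f) *\<^sub>R f)"
    have g_apply: "blinfun_apply g y = (\<Sum>f\<in>\<Phi>. (blinfun_apply f x - F f) * blinfun_apply f y)" for y
      by (simp add: g_def blinfun.sum_left blinfun.scaleR_left)
    have F_g: "F g = (\<Sum>f\<in>\<Phi>. (blinfun_apply f x - F f) * F f)"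
      by (simp add: g_def blinfun.sum_right blinfun.scaleR_right)
    have gx: "blinfun_apply g x - F g = Q x"
      unfolding g_apply F_g Q_def sum_subtractf[symmetric]
      by (intro sum.cong refl) (simp add: power2_eq_square algebra_simps)
    \<comment> \<open>\<open>Q\<close> cannot fall below \<open>m\<close> on the segment from
      \<open>x\<close> to \<open>y\<close>. After expansion and division by \<open>t\<close>, the
      choice of \<open>x\<close> contributes \<open>m / 2\<close> and the quadratic term less than
      \<open>m\<close>; half of the total is \<open>3 * m / 4\<close>.\<close>
    have lower: "blinfun_apply g y \<ge> blinfun_apply g x - 3 * m / 4" if y: "y \<in> B" for y
    proof -
      have xt: "x + t *\<^sub>R (y - x) \<in> B"
      proof -
        have "norm (x + t *\<^sub>R (y - x)) = norm ((1 - t) *\<^sub>R x + t *\<^sub>R y)"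
          by (simp add: algebra_simps)
        also have "\<dots> \<le> (1 - t) * norm x + t * norm y"
          using t by (metis abs_of_nonneg diff_ge_0_iff_ge less_imp_le norm_scaleR norm_triangle_ineq)
        also have "\<dots> \<le> (1 - t) * norm F + t * norm F"
          using t x y by (intro add_mono mult_left_mono) (auto simp: B_def)
        finally show ?thesis by (simp add: B_def algebra_simps)
      qed
      have "Q (x + t *\<^sub>R (y - x)) = Q x + 2 * t * (blinfun_apply g y - blinfun_apply g x)
          + t\<^sup>2 * (\<Sum>f\<in>\<Phi>. (blinfun_apply f (y - x))\<^sup>2)"
        unfolding Q_def g_apply sum_subtractf[symmetric] sum_distrib_left sum.distrib[symmetric]
        by (intro sum.cong refl)
          (simp add: blinfun.add_right blinfun.scaleR_right blinfun.diff_right power2_eq_square algebra_simps)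
      moreover have "(\<Sum>f\<in>\<Phi>. (blinfun_apply f (y - x))\<^sup>2) \<le> C"
        unfolding C_def
      proof (intro sum_mono)
        fix f
        have "norm (y - x) \<le> 2 * norm F"
          using norm_triangle_ineq4[of y x] x y by (simp add: B_def)
        then have "\<bar>blinfun_apply f (y - x)\<bar> \<le> norm f * (2 * norm F)"
          using norm_blinfun[of f "y - x"] by (smt (verit) mult_left_mono norm_ge_zero real_norm_def)
        then show "(blinfun_apply f (y - x))\<^sup>2 \<le> (2 * norm F * norm f)\<^sup>2"
          by (intro iffD1[OF abs_le_square_iff]) (simp add: abs_mult mult_ac)
      qed
      ultimately have "m \<le> m + t * m / 2 + 2 * t * (blinfun_apply g y - blinfun_apply g x) + t\<^sup>2 * C"
        using m_le[OF xt] x(2) by (smt (verit) mult_left_mono zero_le_power2)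
      then have "0 \<le> t * (m / 2 + 2 * (blinfun_apply g y - blinfun_apply g x) + t * C)"
        by (simp add: algebra_simps power2_eq_square)
      then have "0 \<le> m / 2 + 2 * (blinfun_apply g y - blinfun_apply g x) + t * C"
        using t by (simp add: zero_le_mult_iff)
      then show ?thesis using t(3) by (simp add: field_simps)
    qed
    \<comment> \<open>Scaling a vector to norm \<open>norm F\<close> and using both signs turns the
      lower bound on the ball into a bound for the norm of \<open>g\<close>.\<close>
    have "norm F * norm g \<le> 3 * m / 4 - blinfun_apply g x"
    proof (cases "F = 0")
      case True
      then show ?thesis using lower[OF B0] by simp
    next
      case False
      have "norm g \<le> (3 * m / 4 - blinfun_apply g x) / norm F"
      proof (rule norm_blinfun_bound)
        have "0 \<le> 3 * m / 4 - blinfun_apply g x" using lower[OF B0] by simp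
        then show "0 \<le> (3 * m / 4 - blinfun_apply g x) / norm F" by simp
        fix y :: 'y
        show "norm (blinfun_apply g y) \<le> (3 * m / 4 - blinfun_apply g x) / norm F * norm y"
        proof (cases "y = 0")
          case False
          define c where "c = norm F / norm y"
          have c: "c > 0" using False \<open>F \<noteq> 0\<close> by (simp add: c_def)
          have "c *\<^sub>R y \<in> B" "(- c) *\<^sub>R y \<in> B" using False by (auto simp: B_def c_def)
          from this[THEN lower] have "c * \<bar>blinfun_apply g y\<bar> \<le> 3 * m / 4 - blinfun_apply g x"
            by (auto simp: blinfun.scaleR_right blinfun.minus_right abs_if)
          then show ?thesis using False \<open>F \<noteq> 0\<close> by (simp add: c_def field_simps)
        qed (simp add: blinfun.zero_right)
      qed
      then show ?thesis using False by (simp add: field_simps)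
    qed
    moreover have "- (norm F * norm g) \<le> F g"
      using norm_blinfun[of F g] by simp
    ultimately have "Q x \<le> 3 * m / 4" using gx by simp
    then show False using m_le[OF x(1)] m by simp
  qed
  then have "Inf (Q ` B) < \<delta>\<^sup>2" using \<open>\<delta> > 0\<close> by (simp add: m_def[symmetric] le_less_trans)
  with cInf_lessD[of "Q ` B"] B0 obtain x where x: "x \<in> B" "Q x < \<delta>\<^sup>2"
    by blast
  have "\<bar>blinfun_apply f x - F f\<bar> < \<delta>" if "f \<in> \<Phi>" for f
  proof -
    have "(blinfun_apply f x - F f)\<^sup>2 \<le> Q x"
      unfolding Q_def using assms(1) that by (intro member_le_sum) auto
    then have "\<bar>blinfun_apply f x - F f\<bar>\<^sup>2 < \<delta>\<^sup>2" using x by simp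
    then show ?thesis using \<open>\<delta> > 0\<close> by (metis abs_ge_zero less_imp_le power2_less_imp_less)
  qed
  with x show ?thesis by (auto simp: B_def)
qed

text \<open>Finitely many of the sets \<open>W p\<close> have a common point by
  \<open>Helly_approximation\<close>. They therefore generate a proper filter, and an ultrafilter
  below it converges to \<open>F\<close> on every functional.\<close>

lemma ex_ultrafilter_weak_star:
  fixes F :: "('y::real_normed_vector \<Rightarrow>\<^sub>L real) \<Rightarrow>\<^sub>L real"
  obtains U :: "'y filter" where "U \<noteq> bot" "\<And>P. eventually P U \<or> eventually (\<lambda>x. \<not> P x) U"
    "eventually (\<lambda>x. norm x \<le> norm F) U"
    "\<And>f. ((\<lambda>x. blinfun_apply f x) \<longlongrightarrow> blinfun_apply F f) U"
proof -
  define W where "W = (\<lambda>(f::'y \<Rightarrow>\<^sub>L real, \<delta>::real).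
    principal {x. norm x \<le> norm F \<and> \<bar>blinfun_apply f x - F f\<bar> < \<delta>})"
  define N where "N = (INF p\<in>UNIV \<times> {0<..}. W p)"
  have "N \<noteq> bot"
    unfolding N_def
  proof (rule INF_filter_not_bot)
    fix X :: "(('y \<Rightarrow>\<^sub>L real) \<times> real) set"
    assume X: "X \<subseteq> UNIV \<times> {0<..}" "finite X"
    \<comment> \<open>Inserting 1 keeps the minimum defined when \<open>X\<close> is empty.\<close>
    define \<delta> where "\<delta> = Min (insert 1 (snd ` X))"
    have "\<delta> > 0" unfolding \<delta>_def using X by (subst Min_gr_iff) auto
    with X(2) obtain x where x: "norm x \<le> norm F"
        "\<And>f. f \<in> fst ` X \<Longrightarrow> \<bar>blinfun_apply f x - F f\<bar> < \<delta>"
      using Helly_approximation[of "fst ` X" \<delta> F] by blast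
    have "principal {x} \<le> W p" if "p \<in> X" for p
    proof -
      have "\<delta> \<le> snd p" unfolding \<delta>_def using that X(2) by (intro Min_le) auto
      then show ?thesis
        using x(1) x(2)[of "fst p"] that by (force simp: W_def case_prod_beta)
    qed
    then have "principal {x} \<le> (INF p\<in>X. W p)" by (intro INF_greatest)
    then show "(INF p\<in>X. W p) \<noteq> bot"
      by (metis insert_not_empty le_bot principal_eq_bot_iff)
  qed
  then obtain U where U: "U \<noteq> bot" "U \<le> N" "\<And>P. eventually P U \<or> eventually (\<lambda>x. \<not> P x) U"
    by (rule ex_ultrafilter_le) blast
  have ev: "eventually (\<lambda>x. norm x \<le> norm F \<and> \<bar>blinfun_apply f x - F f\<bar> < \<delta>) U" if "\<delta> > 0" for f \<delta>
  proof -
    have "U \<le> W (f, \<delta>)" using U(2) that unfolding N_def by (auto simp: le_INF_iff)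
    then show ?thesis by (simp add: W_def le_principal)
  qed
  show ?thesis
  proof (rule that[OF U(1) U(3)])
    show "eventually (\<lambda>x. norm x \<le> norm F) U" 
      using ev[of 1 0] by (auto elim: eventually_mono)
    show "((\<lambda>x. blinfun_apply f x) \<longlongrightarrow> blinfun_apply F f) U" for f
    proof (rule tendstoI)
      fix e :: real assume "e > 0"
      then show "eventually (\<lambda>x. dist (blinfun_apply f x) (F f) < e) U" 
        using ev[of e f] by (auto simp: dist_real_def elim!: eventually_mono)
    qed
  qed
qed

section \<open>Iterated norms\<close>

text \<open>\<open>u\<close> collects the terms whose points are already chosen, so the first
  coefficient belongs to the outermost limit. Existence of the limits is
  \<open>iterated_norm_tendsto\<close>.\<close>

fun iterated_norm :: "'y::real_normed_vector filter \<Rightarrow> real list \<Rightarrow> 'y \<Rightarrow> real" where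
  "iterated_norm U [] u = norm u"
| "iterated_norm U (a # as) u = Lim U (\<lambda>x. iterated_norm U as (u + a *\<^sub>R x))"

definition alternating :: "nat \<Rightarrow> nat \<Rightarrow> real list" where
  "alternating M K = concat (replicate M (replicate K 1 @ replicate K (-1)))"

text \<open>For each \<open>p\<close>, the \<open>K\<close> shifts put the weight \<open>g p\<close>
  on \<open>{p..<p + K}\<close> instead of \<open>{..<K}\<close>. These sets differ in at most
  \<open>2 * p\<close> places, so the error does not grow with \<open>K\<close>.\<close>

lemma shift_average_error:
  fixes g :: "nat \<Rightarrow> real"
  shows "(\<Sum>t<T. \<bar>(if t < K then \<Sum>p<l. g p else 0)
      - (\<Sum>s<K. if s \<le> t \<and> t < s + l then g (t - s) else 0)\<bar>) \<le> (\<Sum>p<l. \<bar>g p\<bar> * (2 * real p))"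
proof -
  define ind where "ind P = (if P then 1 else 0 :: real)" for P
  have inner: "(if s \<le> t \<and> t < s + l then g (t - s) else 0) = (\<Sum>p<l. g p * ind (s + p = t))" for s t
  proof (cases "s \<le> t \<and> t < s + l")
    case True
    then have "(\<Sum>p<l. g p * ind (s + p = t)) = (\<Sum>p\<in>{t - s}. g p * ind (s + p = t))"
      by (intro sum.mono_neutral_right) (auto simp: ind_def)
    with True show ?thesis by (simp add: ind_def)
  next
    case False
    then have "(\<Sum>p<l. g p * ind (s + p = t)) = 0" by (intro sum.neutral) (auto simp: ind_def)
    with False show ?thesis by auto
  qed
  have count: "(\<Sum>s<K. ind (s + p = t)) = ind (p \<le> t \<and> t < p + K)" for p t
  proof (cases "p \<le> t \<and> t < p + K")
    case True
    then have "(\<Sum>s<K. ind (s + p = t)) = (\<Sum>s\<in>{t - p}. ind (s + p = t))"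
      by (intro sum.mono_neutral_right) (auto simp: ind_def)
    with True show ?thesis by (simp add: ind_def)
  next
    case False
    then have "(\<Sum>s<K. ind (s + p = t)) = 0" by (intro sum.neutral) (auto simp: ind_def)
    with False show ?thesis by (auto simp: ind_def)
  qed
  have diff: "(if t < K then \<Sum>p<l. g p else 0)
      - (\<Sum>s<K. if s \<le> t \<and> t < s + l then g (t - s) else 0)
    = (\<Sum>p<l. g p * (ind (t < K) - ind (p \<le> t \<and> t < p + K)))" for t
  proof -
    have "(\<Sum>s<K. if s \<le> t \<and> t < s + l then g (t - s) else 0) = (\<Sum>s<K. \<Sum>p<l. g p * ind (s + p = t))"
      by (simp only: inner)
    also have "\<dots> = (\<Sum>p<l. \<Sum>s<K. g p * ind (s + p = t))" by (rule sum.swap)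
    also have "\<dots> = (\<Sum>p<l. g p * ind (p \<le> t \<and> t < p + K))"
      by (simp only: sum_distrib_left[symmetric] count)
    finally show ?thesis
      by (simp add: ind_def right_diff_distrib sum_subtractf)
  qed
  have width: "(\<Sum>t<T. \<bar>ind (t < K) - ind (p \<le> t \<and> t < p + K)\<bar>) \<le> 2 * real p" for p
  proof -
    have "(\<Sum>t<T. \<bar>ind (t < K) - ind (p \<le> t \<and> t < p + K)\<bar>) \<le> (\<Sum>t<T. ind (t \<in> {..<p} \<union> {K..<K + p}))"
      by (intro sum_mono) (auto simp: ind_def)
    also have "\<dots> = real (card ({..<T} \<inter> ({..<p} \<union> {K..<K + p})))"
      by (simp add: ind_def sum.If_cases Int_def)
    also have "\<dots> \<le> real (card ({..<p} \<union> {K..<K + p}))"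
      by (intro of_nat_mono card_mono) auto
    also have "\<dots> \<le> real (card {..<p} + card {K..<K + p})"
      by (intro of_nat_mono card_Un_le)
    finally show ?thesis by simp
  qed
  have "(\<Sum>t<T. \<bar>\<Sum>p<l. g p * (ind (t < K) - ind (p \<le> t \<and> t < p + K))\<bar>)
      \<le> (\<Sum>t<T. \<Sum>p<l. \<bar>g p\<bar> * \<bar>ind (t < K) - ind (p \<le> t \<and> t < p + K)\<bar>)"
    by (intro sum_mono order.trans[OF sum_abs]) (simp add: abs_mult)
  also have "\<dots> = (\<Sum>p<l. \<Sum>t<T. \<bar>g p\<bar> * \<bar>ind (t < K) - ind (p \<le> t \<and> t < p + K)\<bar>)"
    by (rule sum.swap)
  also have "\<dots> \<le> (\<Sum>p<l. \<bar>g p\<bar> * (2 * real p))"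
    unfolding sum_distrib_left[symmetric] by (intro sum_mono mult_left_mono width) auto
  finally show ?thesis by (simp only: diff)
qed

section \<open>Existence and seminorm properties of the iterated limits\<close>

locale weak_star_ultrafilter =
  fixes U :: "'y::banach filter" and F :: "('y \<Rightarrow>\<^sub>L real) \<Rightarrow>\<^sub>L real"
  assumes proper: "U \<noteq> bot"
    and ultra: "eventually P U \<or> eventually (\<lambda>x. \<not> P x) U"
    and eventually_norm_le: "eventually (\<lambda>x. norm x \<le> norm F) U"
    and weak_star: "((\<lambda>x. blinfun_apply f x) \<longlongrightarrow> blinfun_apply F f) U"
begin

abbreviation L :: "real list \<Rightarrow> 'y \<Rightarrow> real" where "L \<equiv> iterated_norm U"

text \<open>Bounds and convergence depend on each other: bounds for a shorter list confine the
  values to a compact interval, where the ultrafilter converges, and the limit then bounds the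
  longer list.\<close>

lemma tendsto_if_bounds:
  assumes "\<And>v. 0 \<le> L as v \<and> L as v \<le> norm v + norm F * (\<Sum>a\<leftarrow>as. \<bar>a\<bar>)"
  shows "((\<lambda>x. L as (u + a *\<^sub>R x)) \<longlongrightarrow> L (a # as) u) U"
proof -
  define K where "K = {0..norm u + \<bar>a\<bar> * norm F + norm F * (\<Sum>a\<leftarrow>as. \<bar>a\<bar>)}"
  have "eventually (\<lambda>x. L as (u + a *\<^sub>R x) \<in> K) U"
    using eventually_norm_le
  proof eventually_elim
    case (elim x)
    have "norm (u + a *\<^sub>R x) \<le> norm u + \<bar>a\<bar> * norm x"
      by (metis norm_scaleR norm_triangle_ineq)
    also have "\<dots> \<le> norm u + \<bar>a\<bar> * norm F" using elim by (intro add_left_mono mult_left_mono) auto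
    finally show ?case using assms[of "u + a *\<^sub>R x"] by (auto simp: K_def)
  qed
  moreover have "compact K" by (simp add: K_def)
  ultimately obtain l where "((\<lambda>x. L as (u + a *\<^sub>R x)) \<longlongrightarrow> l) U"
    by (metis ultrafilter_tendsto_compact proper ultra)
  then show ?thesis using proper by (simp add: tendsto_Lim)
qed

lemma iterated_norm_bounds: "0 \<le> L as u \<and> L as u \<le> norm u + norm F * (\<Sum>a\<leftarrow>as. \<bar>a\<bar>)"
proof (induction as arbitrary: u)
  case (Cons a as)
  note lim = tendsto_if_bounds[OF Cons, of u a]
  have "0 \<le> L (a # as) u"
    by (rule tendsto_lowerbound[OF lim _ proper]) (simp add: Cons)
  moreover have "L (a # as) u \<le> norm u + norm F * (\<Sum>a\<leftarrow>a # as. \<bar>a\<bar>)"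
  proof (rule tendsto_upperbound[OF lim _ proper])
    show "eventually (\<lambda>x. L as (u + a *\<^sub>R x) \<le> norm u + norm F * (\<Sum>a\<leftarrow>a # as. \<bar>a\<bar>)) U"
      using eventually_norm_le
    proof eventually_elim
      case (elim x)
      have "norm (u + a *\<^sub>R x) \<le> norm u + \<bar>a\<bar> * norm x"
        by (metis norm_scaleR norm_triangle_ineq)
      also have "\<dots> \<le> norm u + \<bar>a\<bar> * norm F" using elim by (intro add_left_mono mult_left_mono) auto
      finally show ?case using Cons[of "u + a *\<^sub>R x"] by (simp add: algebra_simps)
    qed
  qed
  ultimately show ?case ..
qed simp

lemmas iterated_norm_nonneg = conjunct1[OF iterated_norm_bounds]
lemmas iterated_norm_le = conjunct2[OF iterated_norm_bounds]
lemmas iterated_norm_tendsto = tendsto_if_bounds[OF iterated_norm_bounds]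

declare iterated_norm.simps(2)[simp del]

text \<open>As images of one index list, the summands have equal length, and the triangle inequality
  passes through each limit.\<close>

lemma iterated_norm_add:
  "L (map (\<lambda>t. c t + d t) ts) (u + v) \<le> L (map c ts) u + L (map d ts) v"
proof (induction ts arbitrary: u v)
  case Nil
  then show ?case by (simp add: norm_triangle_ineq)
next
  case (Cons t ts)
  have "eventually (\<lambda>x. L (map (\<lambda>t. c t + d t) ts) (u + v + (c t + d t) *\<^sub>R x)
      \<le> L (map c ts) (u + c t *\<^sub>R x) + L (map d ts) (v + d t *\<^sub>R x)) U"
    using Cons[of "u + c t *\<^sub>R x" "v + d t *\<^sub>R x" for x] by (simp add: algebra_simps)
  then show ?case
    unfolding list.map
    by (intro tendsto_le[OF proper tendsto_add[OF iterated_norm_tendsto iterated_norm_tendsto]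
          iterated_norm_tendsto])
qed

lemma iterated_norm_scale: "L (map ((*) r) as) (r *\<^sub>R u) = \<bar>r\<bar> * L as u"
proof (induction as arbitrary: u)
  case (Cons a as)
  have "((\<lambda>x. \<bar>r\<bar> * L as (u + a *\<^sub>R x)) \<longlongrightarrow> \<bar>r\<bar> * L (a # as) u) U"
    by (intro tendsto_intros iterated_norm_tendsto)
  moreover have "((\<lambda>x. \<bar>r\<bar> * L as (u + a *\<^sub>R x)) \<longlongrightarrow> L (map ((*) r) (a # as)) (r *\<^sub>R u)) U"
    using iterated_norm_tendsto[of "map ((*) r) as" "r *\<^sub>R u" "r * a"]
    by (simp add: Cons[symmetric] scaleR_add_right)
  ultimately show ?case using tendsto_unique[OF proper] by blast
qed simp

lemma iterated_norm_sum:
  assumes "finite S"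
  shows "L (map (\<lambda>t. \<Sum>s\<in>S. c s t) ts) 0 \<le> (\<Sum>s\<in>S. L (map (c s) ts) 0)"
  using assms
proof (induction rule: finite_induct)
  case empty
  show ?case using iterated_norm_scale[of 0 "map (\<lambda>t. 0) ts" 0] by (simp add: o_def)
next
  case (insert s S)
  then show ?case using iterated_norm_add[of "c s" "\<lambda>t. \<Sum>s\<in>S. c s t" ts 0 0] by simp
qed

lemma iterated_norm_Cons_0 [simp]: "L (0 # as) u = L as u"
  using iterated_norm_tendsto[of as u 0] proper by (simp add: tendsto_const_iff)

text \<open>Zeros cost nothing, so lists may be padded at will: only the sequence of nonzero entries
  matters when two lists are compared.\<close>

lemma iterated_norm_filter: "L (filter (\<lambda>a. a \<noteq> 0) as) u = L as u"
proof (induction as arbitrary: u)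
  case (Cons a as)
  show ?case
  proof (cases "a = 0")
    case False
    then show ?thesis by (simp add: Cons iterated_norm.simps(2))
  qed (simp add: Cons)
qed simp

lemma iterated_norm_zeros [simp]: "L (map (\<lambda>t. 0) ts) u = norm u"
  by (induction ts) auto

lemma iterated_norm_append: "L (as @ bs) (u + v) \<le> L as u + L bs v"
proof (induction as arbitrary: u)
  case Nil
  have *: "map (\<lambda>a. 0 + a) bs = bs" by simp
  show ?case using iterated_norm_add[of "\<lambda>_. 0" "\<lambda>a. a" bs u v] by (simp only: *) simp
next
  case (Cons a as)
  have "eventually (\<lambda>x. L (as @ bs) (u + v + a *\<^sub>R x) \<le> L as (u + a *\<^sub>R x) + L bs v) U"
    using Cons[of "u + a *\<^sub>R x" for x] by (simp add: algebra_simps)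
  then show ?case
    unfolding append_Cons
    by (intro tendsto_le[OF proper tendsto_add[OF iterated_norm_tendsto tendsto_const]
          iterated_norm_tendsto])
qed

text \<open>In the weak* limit each point acts on \<open>f\<close> as \<open>F\<close> does, so
  \<open>f\<close> sees only the sum of the coefficients.\<close>

lemma iterated_norm_weak: "\<bar>blinfun_apply f u + sum_list as * F f\<bar> \<le> norm f * L as u"
proof (induction as arbitrary: u)
  case Nil
  then show ?case using norm_blinfun[of f u] by simp
next
  case (Cons a as)
  have "((\<lambda>x. \<bar>blinfun_apply f u + a * blinfun_apply f x + sum_list as * F f\<bar>)
      \<longlongrightarrow> \<bar>blinfun_apply f u + a * F f + sum_list as * F f\<bar>) U"
    by (intro tendsto_intros weak_star)
  moreover have "((\<lambda>x. norm f * L as (u + a *\<^sub>R x)) \<longlongrightarrow> norm f * L (a # as) u) U"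
    by (intro tendsto_intros iterated_norm_tendsto)
  moreover have "eventually (\<lambda>x. \<bar>blinfun_apply f u + a * blinfun_apply f x + sum_list as * F f\<bar>
      \<le> norm f * L as (u + a *\<^sub>R x)) U"
    using Cons[of "u + a *\<^sub>R x" for x] by (simp add: blinfun.add_right blinfun.scaleR_right)
  ultimately show ?case
    using tendsto_le[OF proper] by (fastforce simp: algebra_simps)
qed

text \<open>The limits for \<open>as\<close> are the outer ones and merely change the starting
  vector of \<open>bs\<close>, in which the lower bound is uniform.\<close>

lemma iterated_norm_append_ge:
  assumes "\<And>u. d \<le> L bs u"
  shows "d \<le> L (as @ bs) u"
proof (induction as arbitrary: u)
  case (Cons a as)
  show ?case unfolding append_Cons
    by (rule tendsto_lowerbound[OF iterated_norm_tendsto _ proper]) (simp add: Cons)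
qed (simp add: assms)

section \<open>Positive distance of \<open>F\<close> from the space\<close>

lemma iterated_norm_replicate_mult:
  "L (replicate (s * N) c) (real s *\<^sub>R u) \<le> real s * L (replicate N c) u"
proof (induction s)
  case (Suc s)
  have "L (replicate (Suc s * N) c) (real (Suc s) *\<^sub>R u)
      = L (replicate N c @ replicate (s * N) c) (u + real s *\<^sub>R u)"
    by (simp add: replicate_add algebra_simps)
  also have "\<dots> \<le> L (replicate N c) u + real s * L (replicate N c) u"
    using iterated_norm_append Suc by (rule order.trans[OF _ add_left_mono])
  finally show ?case by (simp add: algebra_simps)
qed simp

text \<open>Subtracting two vectors that carry the same coefficients cancels all limit
  variables.\<close>

lemma norm_diff_le_iterated_norm: "norm (u - v) \<le> L as u + L as v"
proof -
  have "L (map (\<lambda>a. a + (- 1) * a) as) (u + (- 1) *\<^sub>R v) \<le> L (map (\<lambda>a. a) as) u + L (map ((*) (-1)) as) ((- 1) *\<^sub>R v)"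
    by (rule iterated_norm_add)
  moreover have "map (\<lambda>a. a + (- 1) * a) as = map (\<lambda>a. 0) as" by simp
  ultimately show ?thesis unfolding iterated_norm_scale by (simp del: map_replicate_const)
qed

text \<open>If every \<open>d\<close> failed, there would be vectors \<open>u i\<close> almost
  cancelled by \<open>N i\<close> points. The averages \<open>v i\<close> would form a Cauchy
  sequence, and its limit would represent \<open>F\<close>.\<close>

lemma iterated_norm_lower_bound:
  assumes "F \<notin> range canonical_embedding"
  obtains d where "d > 0" "\<And>N u. N \<ge> 1 \<Longrightarrow> real N * d \<le> L (replicate N (- 1)) u"
proof -
  have "\<exists>d>0. \<forall>N\<ge>1. \<forall>u. real N * d \<le> L (replicate N (- 1)) u"
  proof (rule ccontr)
    assume "\<not> ?thesis"
    then have "\<exists>N\<ge>1. \<exists>u. L (replicate N (- 1)) u < real N * (1 / real (Suc i))" for i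
      by (metis not_le of_nat_0_less_iff zero_less_Suc zero_less_divide_1_iff)
    then obtain N u where N: "\<And>i. N i \<ge> 1"
      and u: "\<And>i. L (replicate (N i) (- 1)) (u i) < real (N i) * (1 / real (Suc i))"
      by metis
    define v where "v i = (1 / real (N i)) *\<^sub>R u i" for i
    have N0: "real (N i) > 0" for i using N[of i] by simp
    have dist: "norm (v i - v j) \<le> 1 / real (Suc i) + 1 / real (Suc j)" for i j
    proof -
      \<comment> \<open>Blocks of lengths \<open>N i\<close> and \<open>N j\<close> are repeated up
        to the common length \<open>N i * N j\<close>, so that their coefficients cancel in the
        difference.\<close>
      have le: "L (replicate (N i * N j) (- 1)) (real (N i * N j) *\<^sub>R v i) \<le> real (N i * N j) * (1 / real (Suc i))"
        for i j
      proof -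
        have "L (replicate (N j * N i) (- 1)) (real (N j) *\<^sub>R u i) \<le> real (N j) * L (replicate (N i) (- 1)) (u i)"
          by (rule iterated_norm_replicate_mult)
        also have "\<dots> \<le> real (N j) * (real (N i) * (1 / real (Suc i)))"
          using u[of i] by (intro mult_left_mono) auto
        finally show ?thesis using N0[of i] by (simp add: v_def mult_ac)
      qed
      have "norm (real (N i * N j) *\<^sub>R (v i - v j)) \<le> real (N i * N j) * (1 / real (Suc i) + 1 / real (Suc j))"
        using norm_diff_le_iterated_norm[of "real (N i * N j) *\<^sub>R v i" "real (N i * N j) *\<^sub>R v j"
            "replicate (N i * N j) (- 1)"] le[of i j] le[of j i]
        by (simp only: scaleR_diff_right distrib_left mult.commute[of "N j"])
      then show ?thesis using N0[of i] N0[of j] by simp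
    qed
    have "Cauchy v"
    proof (rule CauchyI)
      fix e :: real assume "e > 0"
      then obtain n where n: "1 / real (Suc n) < e / 2"
        using nat_approx_posE[of "e / 2"] by auto
      have "norm (v i - v j) < e" if "i \<ge> n" "j \<ge> n" for i j
      proof -
        have "1 / real (Suc i) \<le> 1 / real (Suc n)" "1 / real (Suc j) \<le> 1 / real (Suc n)"
          using that by (auto intro!: divide_left_mono)
        with dist[of i j] n show ?thesis by linarith
      qed
      then show "\<exists>M. \<forall>i\<ge>M. \<forall>j\<ge>M. norm (v i - v j) < e" by blast
    qed
    then obtain w where w: "v \<longlonglongrightarrow> w" using Cauchy_convergent_iff convergentD by blast
    have "blinfun_apply f w = F f" for f
    proof -
      have bound: "\<bar>blinfun_apply f (v i) - F f\<bar> \<le> norm f * (1 / real (Suc i))" for i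
      proof -
        have "\<bar>blinfun_apply f (u i) - real (N i) * F f\<bar> \<le> norm f * L (replicate (N i) (- 1)) (u i)"
          using iterated_norm_weak[of f "u i" "replicate (N i) (- 1)"] by (simp add: sum_list_replicate)
        also have "\<dots> \<le> norm f * (real (N i) * (1 / real (Suc i)))"
          using u[of i] by (intro mult_left_mono) auto
        also have "blinfun_apply f (u i) - real (N i) * F f = real (N i) * (blinfun_apply f (v i) - F f)"
          using N0[of i] by (simp add: v_def blinfun.scaleR_right right_diff_distrib)
        finally have "real (N i) * \<bar>blinfun_apply f (v i) - F f\<bar> \<le> real (N i) * (norm f * (1 / real (Suc i)))"
          using N0[of i] by (simp only: abs_mult abs_of_nat mult.left_commute)
        then show ?thesis using N0[of i] by (rule mult_left_le_imp_le)
      qed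
      have "(\<lambda>i. 1 / real (Suc i)) \<longlonglongrightarrow> 0"
        using LIMSEQ_inverse_real_of_nat by (simp only: inverse_eq_divide)
      from tendsto_mult_right_zero[OF this, of "norm f"]
      have "(\<lambda>i. blinfun_apply f (v i) - F f) \<longlonglongrightarrow> 0"
        by (rule Lim_null_comparison[rotated]) (simp only: real_norm_def bound eventually_True)
      moreover have "(\<lambda>i. blinfun_apply f (v i) - F f) \<longlonglongrightarrow> blinfun_apply f w - F f"
        by (intro tendsto_intros w)
      ultimately show ?thesis using LIMSEQ_unique by fastforce
    qed
    then have "F = canonical_embedding w" by (intro blinfun_eqI) simp
    with assms show False by blast
  qed
  with that show ?thesis by blast
qed

text \<open>One sequence of points serves all of \<open>P\<close>: the first point is taken close to
  finitely many outermost limits at once, its term moves into the starting vector, and the remaining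
  points use the other half of \<delta>.\<close>

lemma iterated_norm_approx:
  assumes "finite P" and "\<And>as u. (as, u) \<in> P \<Longrightarrow> length as = n" and "\<delta> > 0"
  shows "\<exists>xs. length xs = n \<and>
    (\<forall>(as, u)\<in>P. \<bar>norm (u + (\<Sum>(a, x)\<leftarrow>zip as xs. a *\<^sub>R x)) - L as u\<bar> < \<delta>)"
  using assms
proof (induction n arbitrary: P \<delta>)
  case 0
  have "as = []" if "(as, u) \<in> P" for as u using 0(2)[OF that] by simp
  with 0(3) show ?case by fastforce
next
  case (Suc n)
  have "eventually (\<lambda>x. \<forall>p\<in>P. \<bar>L (tl (fst p)) (snd p + hd (fst p) *\<^sub>R x) - L (fst p) (snd p)\<bar> < \<delta> / 2) U"
  proof (intro eventually_ball_finite ballI Suc.prems(1))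
    fix p assume p: "p \<in> P"
    obtain a as u where "p = (a # as, u)"
      using Suc.prems(2)[of "fst p" "snd p"] p by (cases p; cases "fst p") auto
    then show "eventually (\<lambda>x. \<bar>L (tl (fst p)) (snd p + hd (fst p) *\<^sub>R x) - L (fst p) (snd p)\<bar> < \<delta> / 2) U"
      using tendstoD[OF iterated_norm_tendsto[of as u a], of "\<delta> / 2"] Suc.prems(3)
      by (simp add: dist_real_def)
  qed
  then obtain x where x: "\<And>p. p \<in> P \<Longrightarrow>
      \<bar>L (tl (fst p)) (snd p + hd (fst p) *\<^sub>R x) - L (fst p) (snd p)\<bar> < \<delta> / 2"
    using eventually_happens'[OF proper] by blast
  define P' where "P' = (\<lambda>p. (tl (fst p), snd p + hd (fst p) *\<^sub>R x)) ` P"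
  have "\<exists>xs. length xs = n \<and>
    (\<forall>(as, u)\<in>P'. \<bar>norm (u + (\<Sum>(a, x)\<leftarrow>zip as xs. a *\<^sub>R x)) - L as u\<bar> < \<delta> / 2)"
    using Suc.prems by (intro Suc.IH) (force simp: P'_def)+
  then obtain xs where xs: "length xs = n"
    "\<And>as u. (as, u) \<in> P' \<Longrightarrow> \<bar>norm (u + (\<Sum>(a, x)\<leftarrow>zip as xs. a *\<^sub>R x)) - L as u\<bar> < \<delta> / 2"
    by blast
  have "\<bar>norm (u + (\<Sum>(a, x)\<leftarrow>zip as (x # xs). a *\<^sub>R x)) - L as u\<bar> < \<delta>" if p: "(as, u) \<in> P" for as u
  proof -
    obtain b bs where as: "as = b # bs" using Suc.prems(2)[OF p] by (cases as) auto
    have "(bs, u + b *\<^sub>R x) \<in> P'" using p as by (force simp: P'_def)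
    from xs(2)[OF this] x[OF p] show ?thesis unfolding as by (simp only: zip_Cons_Cons list.map sum_list.Cons prod.case fst_conv snd_conv list.sel add.assoc)
  qed
  with xs(1) show ?case by (intro exI[of _ "x # xs"]) auto
qed

end

section \<open>Merging of consecutive coefficients\<close>

lemma sum_list_concat: "sum_list (concat xss) = (\<Sum>xs\<leftarrow>xss. sum_list xs)"
  by (induction xss) auto

context weak_star_ultrafilter
begin

text \<open>Averaging the \<open>K\<close> shifts of each group leaves a constant block, up to an error that does
  not depend on \<open>K\<close>.\<close>

lemma iterated_norm_merge:
  assumes "\<And>K. K \<ge> 1 \<Longrightarrow> B * real K \<le> L (concat (map (\<lambda>g. replicate K (sum_list g)) gs)) 0"
  shows "B \<le> L (concat gs) 0"
proof -
  define len where "len i = length (gs ! i)" for i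
  define C where "C = norm F * (\<Sum>i<length gs. \<Sum>p<len i. \<bar>gs ! i ! p\<bar> * (2 * real p))"
  have step: "B * real K \<le> real K * L (concat gs) 0 + C" if K: "K \<ge> 1" for K
  proof -
    \<comment> \<open>Group \<open>i\<close> gets \<open>len i + K\<close> places, room for all
      \<open>K\<close> shifts. \<open>c s\<close> is the pattern with every group shifted by
      \<open>s\<close>, and \<open>w\<close> has the constant blocks.\<close>
    define ts where "ts = concat (map (\<lambda>i. map (Pair i) [0..<len i + K]) [0..<length gs])"
    define c where "c s = (\<lambda>(i, t). if s \<le> t \<and> t < s + len i then gs ! i ! (t - s) else 0)" for s
    define w where "w = (\<lambda>(i, t). if t < K then sum_list (gs ! i) else 0)"
    have gs_eq: "map (\<lambda>i. h (gs ! i)) [0..<length gs] = map h gs" for h :: "real list \<Rightarrow> real list"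
      by (rule nth_equalityI) auto
    have c: "L (map (c s) ts) 0 = L (concat gs) 0" if "s < K" for s
    proof -
      have "map (\<lambda>t. c s (i, t)) [0..<len i + K] = replicate s 0 @ gs ! i @ replicate (K - s) 0" for i
        using that by (intro nth_equalityI) (auto simp: c_def nth_append len_def)
      then have "map (c s) ts = concat (map (\<lambda>i. replicate s 0 @ gs ! i @ replicate (K - s) 0) [0..<length gs])"
        by (simp add: ts_def map_concat o_def)
      then have "filter (\<lambda>a. a \<noteq> 0) (map (c s) ts)
          = concat (map (\<lambda>i. filter (\<lambda>a. a \<noteq> 0) (gs ! i)) [0..<length gs])"
        by (simp add: filter_concat o_def)
      also have "\<dots> = filter (\<lambda>a. a \<noteq> 0) (concat gs)"
        by (simp only: gs_eq filter_concat)
      finally show ?thesis by (metis iterated_norm_filter)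
    qed
    have w: "L (map w ts) 0 = L (concat (map (\<lambda>g. replicate K (sum_list g)) gs)) 0"
    proof -
      have "map (\<lambda>t. w (i, t)) [0..<len i + K] = replicate K (sum_list (gs ! i)) @ replicate (len i) 0" for i
        by (intro nth_equalityI) (auto simp: w_def nth_append)
      then have "map w ts
          = concat (map (\<lambda>i. replicate K (sum_list (gs ! i)) @ replicate (len i) 0) [0..<length gs])"
        by (simp add: ts_def map_concat o_def)
      then have "filter (\<lambda>a. a \<noteq> 0) (map w ts)
          = concat (map (\<lambda>i. filter (\<lambda>a. a \<noteq> 0) (replicate K (sum_list (gs ! i)))) [0..<length gs])"
        by (simp add: filter_concat o_def)
      also have "\<dots> = filter (\<lambda>a. a \<noteq> 0) (concat (map (\<lambda>g. replicate K (sum_list g)) gs))"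
        by (simp only: gs_eq[of "\<lambda>g. filter (\<lambda>a. a \<noteq> 0) (replicate K (sum_list g))"] filter_concat map_map o_def)
      finally show ?thesis by (metis iterated_norm_filter)
    qed
    have err: "L (map (\<lambda>p. w p - (\<Sum>s<K. c s p)) ts) 0 \<le> C"
    proof -
      have sl: "sum_list (gs ! i) = (\<Sum>p<len i. gs ! i ! p)" for i
        by (simp add: sum_list_sum_nth atLeast0LessThan len_def)
      have "(\<Sum>t<len i + K. \<bar>w (i, t) - (\<Sum>s<K. c s (i, t))\<bar>) \<le> (\<Sum>p<len i. \<bar>gs ! i ! p\<bar> * (2 * real p))" for i
        unfolding w_def prod.case sl using shift_average_error[where g = "\<lambda>p. gs ! i ! p" and K = K and l = "len i" and T = "len i + K"]
        by (simp add: c_def len_def)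
      then have "(\<Sum>a\<leftarrow>map (\<lambda>p. w p - (\<Sum>s<K. c s p)) ts. \<bar>a\<bar>)
          \<le> (\<Sum>i<length gs. \<Sum>p<len i. \<bar>gs ! i ! p\<bar> * (2 * real p))"
        unfolding ts_def map_concat sum_list_concat map_map
        by (simp add: o_def interv_sum_list_conv_sum_set_nat atLeast0LessThan sum_mono)
      then show ?thesis
        using iterated_norm_le[of "map (\<lambda>p. w p - (\<Sum>s<K. c s p)) ts" 0]
        unfolding C_def by (smt (verit) mult_left_mono norm_ge_zero norm_zero)
    qed
    have "B * real K \<le> L (map (\<lambda>p. (\<Sum>s<K. c s p) + (w p - (\<Sum>s<K. c s p))) ts) (0 + 0)"
      using assms[OF K] by (simp add: w)
    also have "\<dots> \<le> L (map (\<lambda>p. \<Sum>s<K. c s p) ts) 0 + L (map (\<lambda>p. w p - (\<Sum>s<K. c s p)) ts) 0"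
      by (rule iterated_norm_add)
    also have "\<dots> \<le> (\<Sum>s<K. L (map (c s) ts) 0) + C"
      by (intro add_mono iterated_norm_sum err) simp
    also have "\<dots> = real K * L (concat gs) 0 + C" by (simp add: c)
    finally show ?thesis .
  qed
  \<comment> \<open>The constant \<open>C\<close> is independent of \<open>K\<close>, so it
    disappears from \<open>step\<close> for large \<open>K\<close>.\<close>
  show ?thesis
  proof (rule ccontr)
    assume "\<not> ?thesis"
    then have pos: "B - L (concat gs) 0 > 0" by simp
    then obtain K where K: "C < real K * (B - L (concat gs) 0)"
      using ex_less_of_nat_mult by blast
    also have "\<dots> \<le> real (Suc K) * (B - L (concat gs) 0)"
      using pos by (intro mult_right_mono) auto
    finally show False using step[of "Suc K"] by (simp add: algebra_simps)
  qed
qed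

text \<open>The last block consists of \<open>K\<close> entries \<open>- 1\<close> and is bounded
  below for every starting vector, whatever precedes it.\<close>

lemma alternating_lower_bound:
  assumes "\<And>N u. N \<ge> 1 \<Longrightarrow> real N * d \<le> L (replicate N (- 1)) u" and "M \<ge> 1" "K \<ge> 1"
  shows "real K * d \<le> L (alternating M K) u"
proof -
  obtain M' where M: "M = Suc M'" using assms(2) by (cases M) auto
  have "replicate (Suc M') xs = replicate M' xs @ [xs]" for xs :: "real list"
    by (simp add: replicate_append_same)
  then have "alternating M K = (alternating M' K @ replicate K 1) @ replicate K (- 1)"
    by (simp add: alternating_def M del: replicate.simps)
  then show ?thesis
    by (simp only:) (rule iterated_norm_append_ge, rule assms(1), rule assms(3))
qed

text \<open>Used when only half of the \<open>2 ^ k\<close> bit vectors distinguish two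
  branches.\<close>

lemma alternating_double: "L (alternating (2 * G) K) 0 \<le> 2 * L (alternating G K) 0"
proof -
  have "alternating (2 * G) K = alternating G K @ alternating G K"
    by (simp add: alternating_def mult_2 replicate_add)
  then show ?thesis using iterated_norm_append[of "alternating G K" "alternating G K" 0 0] by simp
qed

end

section \<open>Subsets of an interval attached to the vertices\<close>

definition refine :: "nat \<Rightarrow> (diamond_vertex \<times> diamond_vertex) set \<Rightarrow> (diamond_vertex \<times> diamond_vertex) set" where
  "refine k E = (\<Union>(u, v)\<in>E. \<Union>i<k. {(u, Mid u v i), (Mid u v i, v)})"

text \<open>The edges of a copy of the diamond graph of level \<open>r\<close> with poles
  \<open>a\<close> and \<open>b\<close>; arbitrary poles allow induction over nested copies.\<close>

definition edges_between ::
    "nat \<Rightarrow> diamond_vertex \<Rightarrow> diamond_vertex \<Rightarrow> nat \<Rightarrow> (diamond_vertex \<times> diamond_vertex) set" where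
  "edges_between k a b r = (refine k ^^ r) {(a, b)}"

lemma diamond_edges_eq: "diamond_edges n k = edges_between k Bottom Top n"
  by (induction n) (simp_all add: edges_between_def refine_def)

lemma edges_between_0: "edges_between k a b 0 = {(a, b)}"
  by (simp add: edges_between_def)

text \<open>The definition subdivides last edges last; since \<open>refine\<close> commutes with
  unions, the first subdivision can be split off instead, leaving two smaller copies per
  path.\<close>

lemma edges_between_Suc:
  "edges_between k a b (Suc r) = (\<Union>i<k. edges_between k a (Mid a b i) r \<union> edges_between k (Mid a b i) b r)"
proof -
  have UN: "(refine k ^^ r) (\<Union>i\<in>I. E i) = (\<Union>i\<in>I. (refine k ^^ r) (E i))" for I :: "nat set" and E
    by (induction r) (auto simp: refine_def)
  have Un: "(refine k ^^ r) (E \<union> E') = (refine k ^^ r) E \<union> (refine k ^^ r) E'" for E E'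
    by (induction r) (auto simp: refine_def)
  have "refine k {(a, b)} = (\<Union>i<k. {(a, Mid a b i)} \<union> {(Mid a b i, b)})"
    by (auto simp: refine_def)
  then have "edges_between k a b (Suc r) = (refine k ^^ r) (\<Union>i<k. {(a, Mid a b i)} \<union> {(Mid a b i, b)})"
    by (simp add: edges_between_def funpow_swap1)
  then show ?thesis by (simp only: UN Un edges_between_def)
qed

lemma finite_edges_between: "finite (edges_between k a b r)"
  by (induction r arbitrary: a b) (simp_all add: edges_between_0 edges_between_Suc)

text \<open>An edge \<open>(u, v)\<close> that is replaced by \<open>k\<close> paths carries an interval
  \<open>cover n \<beta> v - cover n \<beta> u\<close> of even length; its midpoint \<open>Mid u v i\<close> receives the left or the
  right half of that interval, according to \<open>\<beta> i\<close>.\<close>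

fun cover :: "nat \<Rightarrow> (nat \<Rightarrow> bool) \<Rightarrow> diamond_vertex \<Rightarrow> nat set" where
  "cover n \<beta> Bottom = {}"
| "cover n \<beta> Top = {..<2 ^ n}"
| "cover n \<beta> (Mid u v i) = cover n \<beta> u \<union>
     (let E = cover n \<beta> v - cover n \<beta> u in {t \<in> E. t < Min E + card E div 2 \<longleftrightarrow> \<beta> i})"

text \<open>The number of edges by which a vertex lies above \<open>Bottom\<close>; real values make
  the halving exact.\<close>

fun height :: "nat \<Rightarrow> diamond_vertex \<Rightarrow> real" where
  "height n Bottom = 0"
| "height n Top = 2 ^ n"
| "height n (Mid u v i) = (height n u + height n v) / 2"

text \<open>The invariant of the nested copies met on descending from the poles. It holds for all
  bit vectors at once, although the interval depends on \<beta>.\<close>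

definition admissible :: "nat \<Rightarrow> nat \<Rightarrow> diamond_vertex \<Rightarrow> diamond_vertex \<Rightarrow> nat \<Rightarrow> bool" where
  "admissible n k a b r \<longleftrightarrow>
     edges_between k a b r \<subseteq> diamond_adj n k \<and> height n b = height n a + 2 ^ r \<and>
     (\<forall>\<beta>. real (card (cover n \<beta> a)) = height n a \<and>
        cover n \<beta> a \<subseteq> cover n \<beta> b \<and> cover n \<beta> b \<subseteq> {..<2 ^ n} \<and>
        (\<exists>x. cover n \<beta> b - cover n \<beta> a = {x..<x + 2 ^ r}))"

lemma cover_Mid:
  assumes "cover n \<beta> v - cover n \<beta> u = {x..<x + 2 * w}" and "w > 0"
  shows "cover n \<beta> (Mid u v i) = cover n \<beta> u \<union> (if \<beta> i then {x..<x + w} else {x + w..<x + 2 * w})"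
proof -
  have "Min {x..<x + 2 * w} = x" using assms(2) by (intro Min_eqI) auto
  then show ?thesis by (auto simp: assms(1) Let_def)
qed

lemma admissible_Bottom_Top: "admissible n k Bottom Top n"
  unfolding admissible_def by (auto simp: diamond_adj_def diamond_edges_eq lessThan_atLeast0 intro!: exI[of _ 0])

lemma admissibleD:
  assumes "admissible n k a b r"
  shows "edges_between k a b r \<subseteq> diamond_adj n k" and "height n b = height n a + 2 ^ r"
    and "real (card (cover n \<beta> a)) = height n a" and "cover n \<beta> a \<subseteq> cover n \<beta> b"
    and "cover n \<beta> b \<subseteq> {..<2 ^ n}" and "\<exists>x. cover n \<beta> b - cover n \<beta> a = {x..<x + 2 ^ r}"
  using assms unfolding admissible_def by blast+

lemma admissible_Mid:
  assumes "admissible n k a b (Suc r)" and "i < k"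
  shows "admissible n k a (Mid a b i) r" and "admissible n k (Mid a b i) b r"
proof -
  have edges: "edges_between k a (Mid a b i) r \<subseteq> diamond_adj n k"
      "edges_between k (Mid a b i) b r \<subseteq> diamond_adj n k"
    and height: "height n b = height n a + 2 * 2 ^ r"
    using assms by (auto simp: admissible_def edges_between_Suc)
  have cover: "real (card (cover n \<beta> a)) = height n a \<and> real (card (cover n \<beta> (Mid a b i))) = height n a + 2 ^ r \<and>
      cover n \<beta> a \<subseteq> cover n \<beta> (Mid a b i) \<and> cover n \<beta> (Mid a b i) \<subseteq> cover n \<beta> b \<and>
      cover n \<beta> b \<subseteq> {..<2 ^ n} \<and>
      (\<exists>x. cover n \<beta> (Mid a b i) - cover n \<beta> a = {x..<x + 2 ^ r}) \<and>
      (\<exists>x. cover n \<beta> b - cover n \<beta> (Mid a b i) = {x..<x + 2 ^ r})" for \<beta>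
  proof -
    obtain x where x: "cover n \<beta> b - cover n \<beta> a = {x..<x + 2 * 2 ^ r}"
      using admissibleD(6)[OF assms(1)] by auto
    have ab: "cover n \<beta> a \<subseteq> cover n \<beta> b" "cover n \<beta> b \<subseteq> {..<2 ^ n}"
        and card: "real (card (cover n \<beta> a)) = height n a"
      using admissibleD[OF assms(1)] by blast+
    \<comment> \<open>The half starting at \<open>y\<close> goes to the midpoint and is what the
      lower copy adds; the half starting at \<open>z\<close> is left to the upper copy.\<close>
    define y where "y = (if \<beta> i then x else x + 2 ^ r)"
    define z where "z = (if \<beta> i then x + 2 ^ r else x)"
    have M: "cover n \<beta> (Mid a b i) = cover n \<beta> a \<union> {y..<y + 2 ^ r}"
      using cover_Mid[OF x, of i] by (auto simp: y_def)
    have E: "{x..<x + 2 * 2 ^ r} = {y..<y + 2 ^ r} \<union> {z..<z + 2 ^ r}" "{y..<y + 2 ^ r} \<inter> {z..<z + 2 ^ r} = {}"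
      by (auto simp: y_def z_def)
    have disj: "cover n \<beta> a \<inter> {y..<y + 2 ^ r} = {}" "cover n \<beta> a \<inter> {z..<z + 2 ^ r} = {}"
      "{y..<y + 2 ^ r} \<subseteq> cover n \<beta> b"
      using x E by blast+
    have "finite (cover n \<beta> a)" using ab by (meson finite_lessThan finite_subset)
    then have "card (cover n \<beta> (Mid a b i)) = card (cover n \<beta> a) + 2 ^ r"
      unfolding M using disj by (subst card_Un_disjoint) auto
    moreover have "cover n \<beta> (Mid a b i) - cover n \<beta> a = {y..<y + 2 ^ r}"
      unfolding M using disj by blast
    moreover have "cover n \<beta> b - cover n \<beta> (Mid a b i) = {z..<z + 2 ^ r}"
      unfolding M using disj x E by blast
    ultimately show ?thesis using card ab disj M by auto
  qed
  show "admissible n k a (Mid a b i) r" "admissible n k (Mid a b i) b r"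
    unfolding admissible_def using edges height cover by (auto simp del: cover.simps) blast+
qed

lemma admissible_edge:
  assumes "admissible n k a b r" and "(u, v) \<in> edges_between k a b r"
  shows "admissible n k u v 0"
  using assms
proof (induction r arbitrary: a b)
  case (Suc r)
  from Suc.prems(2) obtain i where "i < k"
    "(u, v) \<in> edges_between k a (Mid a b i) r \<or> (u, v) \<in> edges_between k (Mid a b i) b r"
    by (auto simp: edges_between_Suc)
  with Suc.IH admissible_Mid[OF Suc.prems(1)] show ?case by blast
qed (simp add: edges_between_0)

section \<open>Walks and heights inside a copy\<close>

lemma Field_edges_between_Suc:
  "Field (edges_between k a b (Suc r))
    = (\<Union>i<k. Field (edges_between k a (Mid a b i) r) \<union> Field (edges_between k (Mid a b i) b r))"
  by (auto simp: edges_between_Suc Field_def)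

lemma diamond_adj_relpow_sym: "(u, v) \<in> diamond_adj n k ^^ m \<Longrightarrow> (v, u) \<in> diamond_adj n k ^^ m"
proof (induction m arbitrary: u v)
  case (Suc m)
  then obtain w where "(u, w) \<in> diamond_adj n k ^^ m" "(w, v) \<in> diamond_adj n k" by auto
  then have "(w, u) \<in> diamond_adj n k ^^ m" "(v, w) \<in> diamond_adj n k"
    using Suc.IH by (auto simp: diamond_adj_def)
  then show ?case using relpow_Suc_I2 by fast
qed simp

text \<open>Real lengths allow differences of heights. Any walk will do, since it bounds the graph
  distance from above.\<close>

definition walk :: "nat \<Rightarrow> nat \<Rightarrow> diamond_vertex \<Rightarrow> diamond_vertex \<Rightarrow> real \<Rightarrow> bool" where
  "walk n k u v x \<longleftrightarrow> (\<exists>m. real m = x \<and> (u, v) \<in> diamond_adj n k ^^ m)"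

lemma walk_trans: "walk n k u v x \<Longrightarrow> walk n k v w y \<Longrightarrow> walk n k u w (x + y)"
  unfolding walk_def by (metis of_nat_add relpow_trans)

lemma walk_sym: "walk n k u v x \<Longrightarrow> walk n k v u x"
  unfolding walk_def by (metis diamond_adj_relpow_sym)

lemma walk_refl: "walk n k u u 0"
  unfolding walk_def by (intro exI[of _ 0]) simp

text \<open>Every vertex of a copy lies on a monotone walk from one pole to the other, along which
  the covers increase.\<close>

lemma admissible_between:
  assumes "admissible n k a b r" and "w \<in> Field (edges_between k a b r)"
  shows "real (card (cover n \<beta> w)) = height n w" and "cover n \<beta> a \<subseteq> cover n \<beta> w"
    and "cover n \<beta> w \<subseteq> cover n \<beta> b" and "walk n k a w (height n w - height n a)"
    and "walk n k w b (height n b - height n w)"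
proof -
  have "real (card (cover n \<beta> w)) = height n w \<and> cover n \<beta> a \<subseteq> cover n \<beta> w \<and>
    cover n \<beta> w \<subseteq> cover n \<beta> b \<and> walk n k a w (height n w - height n a) \<and>
    walk n k w b (height n b - height n w)"
    using assms
  proof (induction r arbitrary: a b w)
    case 0
    then have w: "w = a \<or> w = b" by (auto simp: edges_between_0 Field_def)
    obtain x where "cover n \<beta> b - cover n \<beta> a = {x..<x + 2 ^ 0}"
      using admissibleD(6)[OF 0(1)] by blast
    then have x: "cover n \<beta> b - cover n \<beta> a = {x}" "cover n \<beta> a \<subseteq> cover n \<beta> b" "cover n \<beta> b \<subseteq> {..<2 ^ n}"
      and h: "real (card (cover n \<beta> a)) = height n a" "height n b = height n a + 1"
      using admissibleD(2-5)[OF 0(1)] by (auto simp: atLeastLessThanSuc)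
    have b: "cover n \<beta> b = insert x (cover n \<beta> a)" "x \<notin> cover n \<beta> a" using x by auto
    have "finite (cover n \<beta> b)" using x(3) by (meson finite_lessThan finite_subset)
    then have "real (card (cover n \<beta> b)) = height n b" using b h by simp
    moreover have "walk n k a b 1"
      using 0(1) unfolding walk_def by (intro exI[of _ 1]) (simp add: admissible_def edges_between_0)
    ultimately show ?case using w x h walk_refl by auto
  next
    case (Suc r)
    then obtain i where i: "i < k"
      and w: "w \<in> Field (edges_between k a (Mid a b i) r) \<or> w \<in> Field (edges_between k (Mid a b i) b r)"
      by (auto simp: Field_edges_between_Suc)
    note adm = admissible_Mid[OF Suc.prems(1) i]
    \<comment> \<open>The midpoint is a pole of both smaller copies, so a walk inside one of them
      can be prolonged through the other.\<close>
    have "Mid a b i \<in> Field (edges_between k a (Mid a b i) r) \<and> Mid a b i \<in> Field (edges_between k (Mid a b i) b r)"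
      (is "?m \<in> ?A \<and> ?m \<in> ?B")
    proof -
      have "a \<in> Field (edges_between k a b r) \<and> b \<in> Field (edges_between k a b r)" for a b
        using i by (induction r arbitrary: a b) (auto simp: edges_between_0 Field_edges_between_Suc)
      then show ?thesis by blast
    qed
    then have m: "cover n \<beta> a \<subseteq> cover n \<beta> ?m" "cover n \<beta> ?m \<subseteq> cover n \<beta> b"
      "walk n k a ?m (height n ?m - height n a)" "walk n k ?m b (height n b - height n ?m)"
      using Suc.IH[OF adm(1), of ?m] Suc.IH[OF adm(2), of ?m] by simp_all
    from w show ?case
    proof
      assume "w \<in> ?A"
      note IH = Suc.IH[OF adm(1) this]
      from IH have "walk n k w b ((height n ?m - height n w) + (height n b - height n ?m))"
        using m(4) walk_trans by blast
      then have "walk n k w b (height n b - height n w)" by (simp del: height.simps)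
      with IH m show ?thesis by blast
    next
      assume "w \<in> ?B"
      note IH = Suc.IH[OF adm(2) this]
      from IH have "walk n k a w ((height n ?m - height n a) + (height n w - height n ?m))"
        using m(3) walk_trans by blast
      then have "walk n k a w (height n w - height n a)" by (simp del: height.simps)
      with IH m show ?thesis by blast
    qed
  qed
  then show "real (card (cover n \<beta> w)) = height n w" and "cover n \<beta> a \<subseteq> cover n \<beta> w"
    and "cover n \<beta> w \<subseteq> cover n \<beta> b" and "walk n k a w (height n w - height n a)"
    and "walk n k w b (height n b - height n w)" by blast+
qed

section \<open>Separation of two vertices by initial or final sums\<close>

definition cover_diff :: "nat \<Rightarrow> (nat \<Rightarrow> bool) \<Rightarrow> diamond_vertex \<Rightarrow> diamond_vertex \<Rightarrow> nat \<Rightarrow> real" where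
  "cover_diff n \<beta> u v t = of_bool (t \<in> cover n \<beta> u) - of_bool (t \<in> cover n \<beta> v)"

lemma sum_cover_diff:
  "finite T \<Longrightarrow> sum (cover_diff n \<beta> u v) T = real (card (T \<inter> cover n \<beta> u)) - real (card (T \<inter> cover n \<beta> v))"
  by (simp add: cover_diff_def sum_subtractf sum.If_cases of_bool_def Int_def)

text \<open>The coefficients of \<open>u - v\<close> belonging to \<open>\<beta>\<close> are \<open>cover_diff n \<beta> u v\<close> followed by its negative.
  If an initial or a final sum is \<open>c\<close>, cutting there merges them into the pair \<open>c, - c\<close>. Among the
  bit vectors \<open>\<beta>\<close>, half satisfy \<open>\<beta> i \<noteq> \<beta> j\<close>.\<close>

definition separated :: "nat \<Rightarrow> nat \<Rightarrow> diamond_vertex \<Rightarrow> diamond_vertex \<Rightarrow> bool" where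
  "separated n k u v \<longleftrightarrow> (\<exists>c x i j. walk n k u v x \<and> x \<le> 2 * \<bar>c\<bar> \<and> i < k \<and> j < k \<and> i \<noteq> j \<and>
     (\<forall>\<beta>. \<beta> i \<noteq> \<beta> j \<longrightarrow> (\<exists>s\<le>2 ^ n. sum (cover_diff n \<beta> u v) {..<s} = c \<or>
        sum (cover_diff n \<beta> u v) {s..<2 ^ n} = c)))"

lemma separated_sym:
  assumes "separated n k u v"
  shows "separated n k v u"
proof -
  have neg: "sum (cover_diff n \<beta> v u) T = - sum (cover_diff n \<beta> u v) T" for \<beta> T
    by (simp add: cover_diff_def sum_subtractf)
  obtain c x i j where *: "walk n k u v x \<and> x \<le> 2 * \<bar>c\<bar> \<and> i < k \<and> j < k \<and> i \<noteq> j \<and>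
     (\<forall>\<beta>. \<beta> i \<noteq> \<beta> j \<longrightarrow> (\<exists>s\<le>2 ^ n. sum (cover_diff n \<beta> u v) {..<s} = c \<or>
        sum (cover_diff n \<beta> u v) {s..<2 ^ n} = c))"
    using assms unfolding separated_def by (elim exE)
  show ?thesis
    unfolding separated_def neg
    by (rule exI[of _ "- c"], rule exI[of _ x], rule exI[of _ i], rule exI[of _ j],
        unfold neg_equal_iff_equal abs_minus_cancel,
        rule conjI[OF walk_sym[OF conjunct1[OF *]] conjunct2[OF *]])
qed

text \<open>When the difference of heights is itself the length of a walk, the sum over the whole
  block is already large enough.\<close>

lemma separated_if_walk:
  assumes "k \<ge> 2" and "admissible n k a b r"
    and u: "u \<in> Field (edges_between k a b r)" and v: "v \<in> Field (edges_between k a b r)"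
    and "walk n k u v (height n v - height n u)"
  shows "separated n k u v"
proof -
  have "cover n \<beta> u \<subseteq> {..<2 ^ n}" "cover n \<beta> v \<subseteq> {..<2 ^ n}" for \<beta>
    using admissible_between(3)[OF assms(2) u] admissible_between(3)[OF assms(2) v]
      admissibleD(5)[OF assms(2)] by (meson subset_trans)+
  then have "sum (cover_diff n \<beta> u v) {..<2 ^ n} = height n u - height n v" for \<beta>
    using admissible_between(1)[OF assms(2) u, of \<beta>] admissible_between(1)[OF assms(2) v, of \<beta>]
    by (simp add: sum_cover_diff Int_absorb1)
  moreover have "height n v - height n u \<ge> 0" using assms(5) by (auto simp: walk_def)
  \<comment> \<open>The total is the same for every bit vector, so any two distinct indices serve,
    here 0 and 1, and the cut lies at an end of the block.\<close>
  ultimately show ?thesis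
    using assms(1,5) unfolding separated_def
    by (intro exI[of _ "height n u - height n v"] exI[of _ "height n v - height n u"] exI[of _ 0] exI[of _ 1])
      auto
qed

text \<open>Induction descends to the smallest copy containing both vertices. There they lie below
  and above one midpoint, hence on a monotone walk, or in branches \<open>i\<close> and
  \<open>j\<close> with \<open>i \<noteq> j\<close>, where a walk through a pole is compared with
  the sum over one half of the interval.\<close>

lemma separated_if_admissible:
  assumes "k \<ge> 2" and "admissible n k a b r"
    and "u \<in> Field (edges_between k a b r)" and "v \<in> Field (edges_between k a b r)"
  shows "separated n k u v"
  using assms(2-)
proof (induction r arbitrary: a b u v)
  case 0
  then have uv: "u = a \<or> u = b" "v = a \<or> v = b" by (auto simp: edges_between_0 Field_def)
  have ab: "a \<in> Field (edges_between k a b 0)" "b \<in> Field (edges_between k a b 0)"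
    by (auto simp: edges_between_0 Field_def)
  have "separated n k a b"
    using separated_if_walk[OF assms(1) 0(1) ab] admissible_between(4)[OF 0(1) ab(2)] by blast
  moreover have "separated n k a a" "separated n k b b"
    using separated_if_walk[OF assms(1) 0(1) ab(1,1)] separated_if_walk[OF assms(1) 0(1) ab(2,2)] walk_refl
    by simp_all
  ultimately show ?case using uv separated_sym by blast
next
  case (Suc r)
  define c where "c = Mid a b"
  define lower where "lower i = Field (edges_between k a (c i) r)" for i
  define upper where "upper i = Field (edges_between k (c i) b r)" for i
  from Suc.prems obtain i j where i: "i < k" "u \<in> lower i \<or> u \<in> upper i"
    and j: "j < k" "v \<in> lower j \<or> v \<in> upper j"
    by (auto simp: Field_edges_between_Suc lower_def upper_def c_def)
  have adm: "admissible n k a (c i) r" "admissible n k (c i) b r" if "i < k" for i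
    using admissible_Mid[OF Suc.prems(1) that] by (simp_all add: c_def)
  have low: "real (card (cover n \<beta> w)) = height n w" "cover n \<beta> a \<subseteq> cover n \<beta> w"
      "cover n \<beta> w \<subseteq> cover n \<beta> (c i)" "walk n k a w (height n w - height n a)"
      "walk n k w (c i) (height n (c i) - height n w)" if "i < k" "w \<in> lower i" for i w \<beta>
    using admissible_between[OF adm(1)] that by (simp_all add: lower_def)
  have up: "real (card (cover n \<beta> w)) = height n w" "cover n \<beta> (c i) \<subseteq> cover n \<beta> w"
      "cover n \<beta> w \<subseteq> cover n \<beta> b" "walk n k (c i) w (height n w - height n (c i))"
      "walk n k w b (height n b - height n w)" if "i < k" "w \<in> upper i" for i w \<beta>
    using admissible_between[OF adm(2)] that by (simp_all add: upper_def)
  have hc: "height n (c i) = height n a + 2 ^ r" "height n b = height n (c i) + 2 ^ r" if "i < k" for i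
    using admissibleD(2)[OF adm(1)] admissibleD(2)[OF adm(2)] that by blast+
  have bn: "cover n \<beta> b \<subseteq> {..<2 ^ n}" for \<beta>
    using admissibleD(5)[OF Suc.prems(1)] .
  show ?case
  proof (cases "i = j")
    case True
    have cross: "separated n k u v" if "u \<in> lower i" "v \<in> upper i"
        and uv: "u \<in> Field (edges_between k a b (Suc r))" "v \<in> Field (edges_between k a b (Suc r))" for u v
      using separated_if_walk[OF assms(1) Suc.prems(1) uv]
        walk_trans[OF low(5)[OF i(1) that(1)] up(4)[OF i(1) that(2)]] by simp
    show ?thesis
      using i j True Suc.IH[OF adm(1)[OF i(1)]] Suc.IH[OF adm(2)[OF i(1)]] cross separated_sym Suc.prems(2,3)
      unfolding lower_def upper_def by blast
  next
    case False
    define half where "half \<beta> i = cover n \<beta> (c i) - cover n \<beta> a" for \<beta> i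
    have interval: "\<exists>x. cover n \<beta> b - cover n \<beta> a = {x..<x + 2 * 2 ^ r} \<and> x + 2 * 2 ^ r \<le> 2 ^ n \<and>
        (\<forall>i. half \<beta> i = (if \<beta> i then {x..<x + 2 ^ r} else {x + 2 ^ r..<x + 2 * 2 ^ r}))" for \<beta>
    proof -
      obtain x where x: "cover n \<beta> b - cover n \<beta> a = {x..<x + 2 * 2 ^ r}"
        using admissibleD(6)[OF Suc.prems(1)] by auto
      have "half \<beta> i = (if \<beta> i then {x..<x + 2 ^ r} else {x + 2 ^ r..<x + 2 * 2 ^ r})" (is "_ = ?I") for i
      proof -
        have "cover n \<beta> (c i) = cover n \<beta> a \<union> ?I"
          unfolding c_def using x by (rule cover_Mid) simp
        moreover have "{x..<x + 2 * 2 ^ r} \<inter> cover n \<beta> a = {}" using x by blast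
        moreover have "?I \<subseteq> {x..<x + 2 * 2 ^ r}" by auto
        ultimately show ?thesis unfolding half_def by blast
      qed
      moreover have "x + 2 * 2 ^ r \<le> 2 ^ n"
      proof -
        have "{x..<x + 2 * 2 ^ r} \<subseteq> {0..<2 ^ n}"
          using x bn[of \<beta>] unfolding lessThan_atLeast0 by blast
        then show ?thesis by simp
      qed
      ultimately show ?thesis using x by blast
    qed
    \<comment> \<open>Cutting at the middle of the interval isolates the two halves, because
      \<open>g\<close> vanishes outside it; which half comes first depends on
      \<open>\<beta> i\<close>.\<close>
    have halves: "\<exists>s\<le>2 ^ n. (sum g {..<s} = sum g (half \<beta> i) \<and> sum g {s..<2 ^ n} = sum g (half \<beta> j)) \<or>
        (sum g {..<s} = sum g (half \<beta> j) \<and> sum g {s..<2 ^ n} = sum g (half \<beta> i))"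
      if "\<beta> i \<noteq> \<beta> j" and g: "\<And>t. t \<notin> cover n \<beta> b - cover n \<beta> a \<Longrightarrow> g t = 0"
      for \<beta> and g :: "nat \<Rightarrow> real"
    proof -
      obtain x where x: "cover n \<beta> b - cover n \<beta> a = {x..<x + 2 * 2 ^ r}" "x + 2 * 2 ^ r \<le> 2 ^ n"
        and half: "\<And>i. half \<beta> i = (if \<beta> i then {x..<x + 2 ^ r} else {x + 2 ^ r..<x + 2 * 2 ^ r})"
        using interval[of \<beta>] by blast
      have g0: "g t = 0" if "t < x \<or> t \<ge> x + 2 * 2 ^ r" for t using g that by (auto simp: x(1))
      have "sum g {..<x + 2 ^ r} = sum g {x..<x + 2 ^ r}"
        by (intro sum.mono_neutral_right) (auto intro!: g0)
      moreover have "sum g {x + 2 ^ r..<2 ^ n} = sum g {x + 2 ^ r..<x + 2 * 2 ^ r}"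
        using x(2) by (intro sum.mono_neutral_right) (auto intro!: g0)
      moreover have "x + 2 ^ r \<le> 2 ^ n" using x(2) by simp
      ultimately show ?thesis using that(1) by (intro exI[of _ "x + 2 ^ r"]) (auto simp: half)
    qed
    have zero: "cover_diff n \<beta> u v t = 0" if "t \<notin> cover n \<beta> b - cover n \<beta> a" for \<beta> t
      using that admissible_between(2,3)[OF Suc.prems(1) Suc.prems(2), of \<beta>]
        admissible_between(2,3)[OF Suc.prems(1) Suc.prems(3), of \<beta>]
      by (auto simp: cover_diff_def of_bool_def)
    have sepI: "separated n k u v" if "walk n k u v x" "x \<le> 2 * \<bar>d\<bar>"
      and d: "\<And>\<beta>. \<beta> i \<noteq> \<beta> j \<Longrightarrow> sum (cover_diff n \<beta> u v) (half \<beta> i) = d \<or> sum (cover_diff n \<beta> u v) (half \<beta> j) = d" for x d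
    proof -
      have "\<exists>s\<le>2 ^ n. sum (cover_diff n \<beta> u v) {..<s} = d \<or> sum (cover_diff n \<beta> u v) {s..<2 ^ n} = d"
        if "\<beta> i \<noteq> \<beta> j" for \<beta>
        using halves[of \<beta> "cover_diff n \<beta> u v", OF that zero] d[OF that] by metis
      with that(1,2) i(1) j(1) False show ?thesis unfolding separated_def by blast
    qed
    have fin: "finite (half \<beta> i)" if "i < k" for \<beta> i
      using admissibleD(4)[OF adm(2)[OF that], of \<beta>] bn[of \<beta>] unfolding half_def by (meson finite_Diff finite_lessThan finite_subset)
    have disj: "half \<beta> i \<inter> half \<beta> j = {}" "cover n \<beta> b = cover n \<beta> a \<union> half \<beta> i \<union> half \<beta> j"
      if "\<beta> i \<noteq> \<beta> j" for \<beta>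
    proof -
      obtain x where x: "cover n \<beta> b - cover n \<beta> a = {x..<x + 2 * 2 ^ r}"
        and half: "\<And>i. half \<beta> i = (if \<beta> i then {x..<x + 2 ^ r} else {x + 2 ^ r..<x + 2 * 2 ^ r})"
        using interval[of \<beta>] by blast
      show "half \<beta> i \<inter> half \<beta> j = {}" using that by (auto simp: half)
      have "half \<beta> i \<union> half \<beta> j = {x..<x + 2 * 2 ^ r}" using that by (auto simp: half)
      then show "cover n \<beta> b = cover n \<beta> a \<union> half \<beta> i \<union> half \<beta> j"
        using x admissibleD(4)[OF Suc.prems(1), of \<beta>] by blast
    qed
    have fincov: "finite (cover n \<beta> w)" if "w \<in> lower l \<or> w \<in> upper l" "l < k" for \<beta> w l
      using that low(3)[OF that(2)] up(3)[OF that(2)] admissibleD(4)[OF adm(2)[OF that(2)], of \<beta>] bn[of \<beta>]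
      by (meson finite_lessThan finite_subset)
    have card_half: "real (card (half \<beta> l)) = 2 ^ r" if "l < k" for \<beta> l
      using interval[of \<beta>] by fastforce
    \<comment> \<open>A lower vertex of branch \<open>l\<close> occupies part of the half of
      \<open>l\<close> and nothing of the other half. An upper vertex fills the half of
      \<open>l\<close> and has its excess over the midpoint in the other half.\<close>
    have half_low: "real (card (half \<beta> l \<inter> cover n \<beta> w)) = height n w - height n a" 
      if "w \<in> lower l" "l < k" for \<beta> w l
    proof -
      have "half \<beta> l \<inter> cover n \<beta> w = cover n \<beta> w - cover n \<beta> a"
        using low(2,3)[OF that(2,1), of \<beta>] unfolding half_def by blast
      then show ?thesis
        using low(1,2)[OF that(2,1), of \<beta>] admissibleD(3)[OF Suc.prems(1), of \<beta>] fincov[of w l \<beta>] that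
        by (simp add: card_Diff_subset finite_subset of_nat_diff card_mono)
    qed
    have half_low_other: "card (half \<beta> l' \<inter> cover n \<beta> w) = 0"
      if "w \<in> lower l" "l < k" "half \<beta> l \<inter> half \<beta> l' = {}" for \<beta> w l l'
    proof -
      have "half \<beta> l' \<inter> cover n \<beta> w = {}"
        using low(3)[OF that(2,1), of \<beta>] that(3) unfolding half_def by blast
      then show ?thesis by simp
    qed
    have half_up: "real (card (half \<beta> l \<inter> cover n \<beta> w)) = 2 ^ r" if "w \<in> upper l" "l < k" for \<beta> w l
    proof -
      have "half \<beta> l \<inter> cover n \<beta> w = half \<beta> l"
        using up(2)[OF that(2,1), of \<beta>] unfolding half_def by blast
      then show ?thesis using card_half[OF that(2)] by simp
    qed
    have half_up_other: "real (card (half \<beta> l' \<inter> cover n \<beta> w)) = height n w - height n (c l)"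
      if "w \<in> upper l" "l < k" "half \<beta> l \<inter> half \<beta> l' = {}"
        "cover n \<beta> b = cover n \<beta> a \<union> half \<beta> l \<union> half \<beta> l'" for \<beta> w l l'
    proof -
      have "half \<beta> l' \<inter> cover n \<beta> w = cover n \<beta> w - cover n \<beta> (c l)"
        using up(2,3)[OF that(2,1), of \<beta>] that(3,4) admissibleD(4)[OF adm(1)[OF that(2)], of \<beta>]
        unfolding half_def by blast
      then show ?thesis
        using up(1,2)[OF that(2,1), of \<beta>] admissibleD(3)[OF adm(2)[OF that(2)], of \<beta>] fincov[of w l \<beta>] that
        by (simp add: card_Diff_subset finite_subset of_nat_diff card_mono)
    qed
    note sums = sum_cover_diff[OF fin]
    have via_a: "walk n k u v ((height n u - height n a) + (height n v - height n a))"
      using walk_trans[OF walk_sym] admissible_between(4)[OF Suc.prems(1,2)]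
        admissible_between(4)[OF Suc.prems(1,3)] by blast
    have via_b: "walk n k u v ((height n b - height n u) + (height n b - height n v))"
      using walk_trans[OF _ walk_sym] admissible_between(5)[OF Suc.prems(1,2)]
        admissible_between(5)[OF Suc.prems(1,3)] by blast
    have nonneg: "height n a \<le> height n w" "height n w \<le> height n b"
      if "w \<in> Field (edges_between k a b (Suc r))" for w
      using admissible_between(4,5)[OF Suc.prems(1) that] by (auto simp: walk_def)
    note h = hc[OF i(1)] hc[OF j(1)] nonneg[OF Suc.prems(2)] nonneg[OF Suc.prems(3)]
    from i(2) j(2) show ?thesis
    proof (elim disjE)
      \<comment> \<open>The walk through \<open>a\<close> is at most twice the larger of the two
        heights above \<open>a\<close>, and each height is the absolute sum over one half.\<close>
      assume uv: "u \<in> lower i" "v \<in> lower j"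
      have S: "sum (cover_diff n \<beta> u v) (half \<beta> i) = height n u - height n a"
          "sum (cover_diff n \<beta> u v) (half \<beta> j) = - (height n v - height n a)" if "\<beta> i \<noteq> \<beta> j" for \<beta>
        using half_low[OF uv(1) i(1), of \<beta>] half_low[OF uv(2) j(1), of \<beta>] disj(1)[of \<beta>, OF that]
          half_low_other[OF uv(1) i(1), of \<beta> j] half_low_other[OF uv(2) j(1), of \<beta> i]
        by (simp_all add: sums i j Int_commute)
      show ?thesis
      proof (cases "height n u \<ge> height n v")
        case True
        then show ?thesis using S h by (intro sepI[OF via_a, of "height n u - height n a"]) auto
      next
        case False
        then show ?thesis using S h by (intro sepI[OF via_a, of "- (height n v - height n a)"]) auto
      qed
    next
      \<comment> \<open>Only \<open>v\<close> meets the half of \<open>j\<close>, and it fills it.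
        The walks through \<open>a\<close> and through \<open>b\<close> have total length
        \<open>4 * 2 ^ r\<close>, so one of them has length at most
        \<open>2 * 2 ^ r\<close>.\<close>
      assume uv: "u \<in> lower i" "v \<in> upper j"
      have S: "sum (cover_diff n \<beta> u v) (half \<beta> j) = - (2 ^ r)" if "\<beta> i \<noteq> \<beta> j" for \<beta>
        using disj(1)[of \<beta>, OF that] half_low_other[OF uv(1) i(1), of \<beta> j] half_up[OF uv(2) j(1), of \<beta>]
        by (simp add: sums j)
      show ?thesis
      proof (cases "(height n u - height n a) + (height n v - height n a) \<le> 2 * 2 ^ r")
        case True
        then show ?thesis using S by (intro sepI[OF via_a, of "- (2 ^ r)"]) auto
      next
        case False
        then show ?thesis using S h by (intro sepI[OF via_b, of "- (2 ^ r)"]) auto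
      qed
    next
      assume uv: "u \<in> upper i" "v \<in> lower j"
      have S: "sum (cover_diff n \<beta> u v) (half \<beta> i) = 2 ^ r" if "\<beta> i \<noteq> \<beta> j" for \<beta>
        using disj(1)[of \<beta>, OF that] half_low_other[OF uv(2) j(1), of \<beta> i] half_up[OF uv(1) i(1), of \<beta>]
        by (simp add: sums i Int_commute)
      show ?thesis
      proof (cases "(height n u - height n a) + (height n v - height n a) \<le> 2 * 2 ^ r")
        case True
        then show ?thesis using S by (intro sepI[OF via_a, of "2 ^ r"]) auto
      next
        case False
        then show ?thesis using S h by (intro sepI[OF via_b, of "2 ^ r"]) auto
      qed
    next
      \<comment> \<open>Each vertex fills its own half, so the sum over that half is the gap left by
        the other vertex, which is its depth below \<open>b\<close>.\<close>
      assume uv: "u \<in> upper i" "v \<in> upper j"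
      have S: "sum (cover_diff n \<beta> u v) (half \<beta> i) = height n b - height n v"
          "sum (cover_diff n \<beta> u v) (half \<beta> j) = - (height n b - height n u)" if "\<beta> i \<noteq> \<beta> j" for \<beta>
        using half_up[OF uv(1) i(1), of \<beta>] half_up[OF uv(2) j(1), of \<beta>] disj[of \<beta>, OF that] h
          half_up_other[OF uv(1) i(1), of \<beta> j] half_up_other[OF uv(2) j(1), of \<beta> i]
        by (simp_all add: sums i j Int_commute Un_ac)
      show ?thesis
      proof (cases "height n u \<ge> height n v")
        case True
        then show ?thesis using S h by (intro sepI[OF via_b, of "height n b - height n v"]) auto
      next
        case False
        then show ?thesis using S h by (intro sepI[OF via_b, of "- (height n b - height n u)"]) auto
      qed
    qed
  qed
qed

section \<open>The embedding\<close>

text \<open>In an entry \<open>(m, s, t)\<close>, the number \<open>m\<close> encodes the bit vector \<open>bit m\<close>, \<open>s\<close> is the sign of the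
  block and \<open>t < 2 ^ n\<close> is the place within the block.\<close>

definition index_list :: "nat \<Rightarrow> nat \<Rightarrow> nat \<Rightarrow> (nat \<times> real \<times> nat) list" where
  "index_list n k N = concat (map (\<lambda>m. concat (map (\<lambda>t. replicate N (m, 1, t)) [0..<2 ^ n]) @
     concat (map (\<lambda>t. replicate N (m, - 1, t)) [0..<2 ^ n])) [0..<2 ^ k])"

text \<open>All patterns are images of one index list, so one sequence of points serves every pair
  of vertices. Each place is repeated \<open>N\<close> times so that edges yield alternating blocks
  of length \<open>N\<close>.\<close>

definition signed_pattern :: "nat \<Rightarrow> nat \<Rightarrow> nat \<Rightarrow> (nat \<Rightarrow> nat \<Rightarrow> real) \<Rightarrow> real list" where
  "signed_pattern n k N g = map (\<lambda>(m, s, t). s * g m t) (index_list n k N)"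

lemma signed_pattern_eq:
  "signed_pattern n k N g = concat (map (\<lambda>m. concat (map (\<lambda>t. replicate N (g m t)) [0..<2 ^ n]) @
     concat (map (\<lambda>t. replicate N (- g m t)) [0..<2 ^ n])) [0..<2 ^ k])"
  by (simp add: signed_pattern_def index_list_def map_concat o_def)

lemma concat_concat: "concat (concat xsss) = concat (map concat xsss)"
  by (induction xsss) auto

lemma concat_if_eq:
  "x < T \<Longrightarrow> concat (map (\<lambda>t. if t = x then ys else []) [0..<T]) = ys"
proof (induction T)
  case (Suc T)
  show ?case
  proof (cases "x = T")
    case True
    have "concat (map (\<lambda>t. if t = T then ys else []) [0..<T]) = []" by auto
    with True show ?thesis by simp
  qed (use Suc in auto)
qed simp

lemma concat_if_mem:
  "concat (map (\<lambda>m. if m \<in> G then ys else []) [0..<T]) = concat (replicate (card (G \<inter> {..<T})) ys)"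
proof (induction T)
  case (Suc T)
  have "G \<inter> {..<Suc T} = (if T \<in> G then insert T (G \<inter> {..<T}) else G \<inter> {..<T})"
    by (auto simp: less_Suc_eq)
  with Suc show ?case by (simp add: replicate_append_same[symmetric] del: replicate.simps)
      (simp add: replicate_append_same[symmetric])
qed simp

text \<open>Flipping bit \<open>i\<close> exchanges the vectors with equal and with different bits
  \<open>i\<close> and \<open>j\<close>.\<close>

lemma card_bits_differ:
  assumes "i < k" "j < k" "i \<noteq> j"
  shows "2 * card ({m. bit m i \<noteq> bit m j} \<inter> {..<2 ^ k :: nat}) = 2 ^ k"
proof -
  define G where "G = {m. bit m i \<noteq> bit m j} \<inter> {..<2 ^ k :: nat}"
  define H where "H = {m. bit m i = bit m j} \<inter> {..<2 ^ k :: nat}"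
  have lt: "flip_bit i m < 2 ^ k" if "m < 2 ^ k" for m :: nat
    using that assms(1) by (metis take_bit_flip_bit_eq take_bit_nat_eq_self_iff not_le)
  have inv: "flip_bit i (flip_bit i m) = m" for m :: nat
    by (rule bit_eqI) (auto simp: bit_flip_bit_iff)
  have "bij_betw (flip_bit i) G H"
    by (rule bij_betw_byWitness[where f' = "flip_bit i"])
      (use assms(3) lt inv in \<open>auto simp: G_def H_def bit_flip_bit_iff\<close>)
  then have "card G = card H" by (rule bij_betw_same_card)
  moreover have "card (G \<union> H) = card G + card H"
    by (rule card_Un_disjoint) (auto simp: G_def H_def)
  moreover have "G \<union> H = {..<2 ^ k}" by (auto simp: G_def H_def)
  ultimately show ?thesis by (simp add: G_def)
qed

section \<open>Iterated norms of signed patterns\<close>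

context weak_star_ultrafilter
begin

text \<open>The position \<open>x\<close> of the single nonzero place may vary with
  \<open>m\<close>: it is lost when zeros are dropped.\<close>

lemma iterated_norm_signed_pattern_point:
  assumes "\<And>m. m < 2 ^ k \<Longrightarrow> \<exists>x<2 ^ n. \<forall>t. g m t = of_bool (t = x)"
  shows "L (signed_pattern n k N g) 0 = L (alternating (2 ^ k) N) 0"
proof -
  obtain x where x: "\<And>m. m < 2 ^ k \<Longrightarrow> x m < 2 ^ n" "\<And>m t. m < 2 ^ k \<Longrightarrow> g m t = of_bool (t = x m)"
    using assms by metis
  have inner: "concat (map (\<lambda>t. filter (\<lambda>a. a \<noteq> 0) (replicate N (s * g m t))) [0..<2 ^ n]) = replicate N s"
    if "m < 2 ^ k" "s \<noteq> 0" for m s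
  proof -
    have "(\<lambda>t. filter (\<lambda>a. a \<noteq> 0) (replicate N (s * g m t))) = (\<lambda>t. if t = x m then replicate N s else [])"
      using that x(2)[of m] by auto
    then show ?thesis using concat_if_eq[OF x(1)[OF that(1)]] by simp
  qed
  have "filter (\<lambda>a. a \<noteq> 0) (signed_pattern n k N g)
      = concat (map (\<lambda>m. replicate N 1 @ replicate N (- 1)) [0..<2 ^ k])"
    unfolding signed_pattern_eq filter_concat map_map
    by (intro arg_cong[where f = concat] map_cong refl)
      (use inner[of _ 1] inner[of _ "- 1"] in \<open>simp add: filter_concat o_def\<close>)
  also have "\<dots> = alternating (2 ^ k) N"
    by (simp add: alternating_def map_replicate_const)
  finally show ?thesis by (metis iterated_norm_filter)
qed

text \<open>Each \<open>m\<close> in \<open>G\<close> is cut into two groups with opposite sums, and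
  every other \<open>m\<close> forms one group of sum 0. Merging then leaves a multiple of an
  alternating pattern.\<close>

lemma iterated_norm_signed_pattern_ge:
  assumes G: "\<And>m. m \<in> G \<Longrightarrow> \<exists>s\<le>2 ^ n. sum (g m) {..<s} = c \<or> sum (g m) {s..<2 ^ n} = c"
    and b: "\<And>K. K \<ge> 1 \<Longrightarrow> b * real K \<le> L (alternating (card (G \<inter> {..<2 ^ k})) K) 0"
    and "N \<ge> 1"
  shows "real N * \<bar>c\<bar> * b \<le> L (signed_pattern n k N g) 0"
proof (cases "c = 0")
  case True
  then show ?thesis by (simp add: iterated_norm_nonneg)
next
  case False
  define block where "block s m ts = concat (map (\<lambda>t. replicate N (s * g m t)) ts)" for s m ts
  have sum_block: "sum_list (block s m [x..<y]) = s * (real N * sum (g m) {x..<y})" for s m x y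
    by (simp add: block_def sum_list_concat o_def sum_list_replicate interv_sum_list_conv_sum_set_nat
        sum_distrib_left mult_ac)
  have block_append: "block s m [0..<2 ^ n] = block s m [0..<x] @ block s m [x..<2 ^ n]" if "x \<le> 2 ^ n" for s m x
    using upt_add_eq_append[of 0 x "2 ^ n - x"] that by (simp add: block_def)
  have "\<exists>gs. concat gs = block 1 m [0..<2 ^ n] @ block (- 1) m [0..<2 ^ n] \<and>
      map sum_list gs = (if m \<in> G then [real N * c, - (real N * c)] else [0])" for m
  proof (cases "m \<in> G")
    case True
    with G obtain x where x: "x \<le> 2 ^ n" "sum (g m) {..<x} = c \<or> sum (g m) {x..<2 ^ n} = c" by blast
    then consider "sum (g m) {0..<x} = c" | "sum (g m) {x..<2 ^ n} = c" by (auto simp: lessThan_atLeast0)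
    then show ?thesis
    proof cases
      \<comment> \<open>With total \<open>S\<close> of \<open>g m\<close>, the first group sums to
        \<open>c\<close> and the second to \<open>(S - c) - S\<close>, up to the factor
        \<open>N\<close>.\<close>
      case 1
      then show ?thesis using True
        by (intro exI[of _ "[block 1 m [0..<x], block 1 m [x..<2 ^ n] @ block (- 1) m [0..<x] @ block (- 1) m [x..<2 ^ n]]"])
          (simp add: block_append[OF x(1)] sum_block)
    next
      \<comment> \<open>Here the cut is in the negative block: its final part sums to
        \<open>- c\<close>, and everything before it to \<open>S - (S - c)\<close>.\<close>
      case 2
      then show ?thesis using True
        by (intro exI[of _ "[block 1 m [0..<x] @ block 1 m [x..<2 ^ n] @ block (- 1) m [0..<x], block (- 1) m [x..<2 ^ n]]"])
          (simp add: block_append[OF x(1)] sum_block)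
    qed
  next
    case False
    then show ?thesis
      by (intro exI[of _ "[block 1 m [0..<2 ^ n] @ block (- 1) m [0..<2 ^ n]]"]) (simp add: sum_block)
  qed
  then obtain gs where gs: "\<And>m. concat (gs m) = block 1 m [0..<2 ^ n] @ block (- 1) m [0..<2 ^ n]"
    "\<And>m. map sum_list (gs m) = (if m \<in> G then [real N * c, - (real N * c)] else [0])"
    by metis
  have pattern: "signed_pattern n k N g = concat (concat (map gs [0..<2 ^ k]))"
    by (simp add: signed_pattern_eq concat_concat o_def gs(1)) (simp add: block_def)
  show ?thesis
    unfolding pattern
  proof (rule iterated_norm_merge)
    fix K :: nat assume K: "K \<ge> 1"
    let ?c = "real N * c"
    have "map (\<lambda>h. replicate K (sum_list h)) (gs m)
        = (if m \<in> G then [replicate K ?c, replicate K (- ?c)] else [replicate K 0])" for m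
    proof -
      have "map (\<lambda>h. replicate K (sum_list h)) (gs m) = map (replicate K) (map sum_list (gs m))" by simp
      then show ?thesis unfolding gs(2) by simp
    qed
    then have "concat (map (\<lambda>h. replicate K (sum_list h)) (concat (map gs [0..<2 ^ k])))
       = concat (map (\<lambda>m. if m \<in> G then replicate K ?c @ replicate K (- ?c) else replicate K 0) [0..<2 ^ k])"
      by (simp add: map_concat concat_concat o_def if_distrib[of concat] cong: if_cong)
    then have "filter (\<lambda>a. a \<noteq> 0) (concat (map (\<lambda>h. replicate K (sum_list h)) (concat (map gs [0..<2 ^ k]))))
       = concat (map (\<lambda>m. if m \<in> G then replicate K ?c @ replicate K (- ?c) else []) [0..<2 ^ k])"
      using False \<open>N \<ge> 1\<close> by (simp add: filter_concat o_def if_distrib[of "filter _"] cong: if_cong)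
    also have "\<dots> = map ((*) ?c) (alternating (card (G \<inter> {..<2 ^ k})) K)"
      by (simp add: concat_if_mem alternating_def map_concat)
    finally have "L (concat (map (\<lambda>h. replicate K (sum_list h)) (concat (map gs [0..<2 ^ k])))) 0
        = L (map ((*) ?c) (alternating (card (G \<inter> {..<2 ^ k})) K)) (?c *\<^sub>R 0)"
      by (metis iterated_norm_filter scaleR_zero_right)
    also have "\<dots> = real N * \<bar>c\<bar> * L (alternating (card (G \<inter> {..<2 ^ k})) K) 0"
      unfolding iterated_norm_scale by (simp add: abs_mult)
    also have "\<dots> \<ge> real N * \<bar>c\<bar> * (b * real K)"
      using b[OF K] by (intro mult_left_mono) auto
    finally show "real N * \<bar>c\<bar> * b * real K \<le> L (concat (map (\<lambda>h. replicate K (sum_list h)) (concat (map gs [0..<2 ^ k])))) 0"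
      by (simp add: mult_ac)
  qed
qed

end

lemma finite_diamond_verts: "finite (diamond_verts n k)"
  by (simp add: diamond_verts_def diamond_edges_eq finite_Field finite_edges_between)

text \<open>Of the factor \<open>1 / 4\<close>, one half comes from using half of the bit vectors
  and one half from \<open>x \<le> 2 * \<bar>c\<bar>\<close>.\<close>

lemma (in weak_star_ultrafilter) diamond_embedding_approx:
  assumes "F \<notin> range canonical_embedding" and "k \<ge> 2" and "\<kappa> > 0"
  shows "\<exists>(h :: diamond_vertex \<Rightarrow> 'y) \<rho>. \<rho> > 0 \<and>
    (\<forall>(u, v)\<in>diamond_edges n k. norm (h u - h v) \<le> \<rho> * (1 + 2 * \<kappa>)) \<and>
    (\<forall>u\<in>diamond_verts n k. \<forall>v\<in>diamond_verts n k. \<exists>x. walk n k u v x \<and> \<rho> * (x / 4 - \<kappa>) \<le> norm (h u - h v))"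
proof -
  obtain d where d: "d > 0" "\<And>N u. N \<ge> 1 \<Longrightarrow> real N * d \<le> L (replicate N (- 1)) u"
    using iterated_norm_lower_bound[OF assms(1)] by blast
  define \<Phi> where "\<Phi> = (\<lambda>K. L (alternating (2 ^ k) K) 0 / real K) ` {1..}"
  define \<phi> where "\<phi> = Inf \<Phi>"
  have d_le: "d \<le> y" if "y \<in> \<Phi>" for y
  proof -
    from that obtain K where K: "K \<ge> 1" "y = L (alternating (2 ^ k) K) 0 / real K"
      by (auto simp: \<Phi>_def)
    then show ?thesis
      using alternating_lower_bound[OF d(2), of "2 ^ k" K 0]
      by (simp add: K(2) pos_le_divide_eq mult.commute)
  qed
  have "\<Phi> \<noteq> {}" by (auto simp: \<Phi>_def)
  have "\<phi> > 0"
    using cInf_greatest[OF \<open>\<Phi> \<noteq> {}\<close> d_le] d(1) by (simp add: \<phi>_def)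
  have \<phi>_le: "\<phi> * real K \<le> L (alternating (2 ^ k) K) 0" if "K \<ge> 1" for K
  proof -
    have "\<phi> \<le> L (alternating (2 ^ k) K) 0 / real K"
      unfolding \<phi>_def using that d_le by (intro cInf_lower bdd_belowI[of _ d]) (auto simp: \<Phi>_def)
    then show ?thesis using that by (simp add: field_simps)
  qed
  \<comment> \<open>Lower bounds only see the infimum \<phi>, so a block length that nearly attains
    it makes the edges nearly as short as these bounds allow.\<close>
  obtain N where N: "N \<ge> 1" "L (alternating (2 ^ k) N) 0 < real N * \<phi> * (1 + \<kappa>)"
  proof -
    have "\<phi> < \<phi> * (1 + \<kappa>)" using \<open>\<phi> > 0\<close> assms(3) by simp
    then obtain y where "y \<in> \<Phi>" "y < \<phi> * (1 + \<kappa>)"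
      using cInf_lessD[OF \<open>\<Phi> \<noteq> {}\<close>] unfolding \<phi>_def by blast
    then obtain K where "K \<ge> 1" "L (alternating (2 ^ k) K) 0 / real K < \<phi> * (1 + \<kappa>)"
      by (auto simp: \<Phi>_def)
    then show ?thesis by (intro that[of K]) (simp_all add: field_simps)
  qed
  define \<rho> where "\<rho> = real N * \<phi>"
  have "\<rho> > 0" using N(1) \<open>\<phi> > 0\<close> by (simp add: \<rho>_def)
  define V where "V = diamond_verts n k"
  have V: "V = Field (edges_between k Bottom Top n)"
    by (simp add: V_def diamond_verts_def diamond_edges_eq)
  define g where "g u v m = cover_diff n (bit m) u v" for u v and m :: nat
  define P where "P = (\<lambda>(u, v). (signed_pattern n k N (g u v), 0 :: 'y)) ` (V \<times> V)"
  have "finite P" unfolding P_def V_def using finite_diamond_verts by blast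
  moreover have "length as = length (index_list n k N)" if "(as, u) \<in> P" for as u
    using that by (auto simp: P_def signed_pattern_def)
  moreover have "\<kappa> * \<rho> > 0" using assms(3) \<open>\<rho> > 0\<close> by simp
  ultimately obtain xs where xs: "\<forall>(as, u)\<in>P. \<bar>norm (u + (\<Sum>(a, x)\<leftarrow>zip as xs. a *\<^sub>R x)) - L as u\<bar> < \<kappa> * \<rho>"
    using iterated_norm_approx by blast
  define h where "h u = (\<Sum>((m, s, t), x)\<leftarrow>zip (index_list n k N) xs. (s * of_bool (t \<in> cover n (bit m) u)) *\<^sub>R x)" for u
  have h_diff: "h u - h v = (\<Sum>(a, x)\<leftarrow>zip (signed_pattern n k N (g u v)) xs. a *\<^sub>R x)" for u v
    unfolding h_def sum_list_subtractf[symmetric] signed_pattern_def zip_map1 map_map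
    by (intro arg_cong[where f = sum_list] map_cong refl)
      (auto simp: g_def cover_diff_def algebra_simps)
  have approx: "\<bar>norm (h u - h v) - L (signed_pattern n k N (g u v)) 0\<bar> < \<kappa> * \<rho>" if "u \<in> V" "v \<in> V" for u v
    using xs that unfolding h_diff P_def by fastforce
  show ?thesis
  proof (rule exI[of _ h], rule exI[of _ \<rho>], intro conjI ballI)
    show "\<rho> > 0" by fact
    fix e assume e: "e \<in> diamond_edges n k"
    obtain u v where uv: "e = (u, v)" by (cases e)
    have adm: "admissible n k u v 0"
      using admissible_edge[OF admissible_Bottom_Top] e uv by (simp add: diamond_edges_eq)
    have "u \<in> V" "v \<in> V" using e uv by (auto simp: V_def diamond_verts_def Field_def)
    have "\<exists>x<2 ^ n. \<forall>t. g v u m t = of_bool (t = x)" for m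
    proof -
      obtain x where "cover n (bit m) v - cover n (bit m) u = {x..<x + 2 ^ 0}"
        using admissibleD(6)[OF adm] by blast
      then have x: "cover n (bit m) v - cover n (bit m) u = {x}" by simp
      moreover from x have "x < 2 ^ n" using admissibleD(5)[OF adm, of "bit m"] by blast
      moreover have "g v u m t = of_bool (t = x)" for t
        using x admissibleD(4)[OF adm, of "bit m"] unfolding g_def cover_diff_def of_bool_def by auto
      ultimately show ?thesis by blast
    qed
    then have "L (signed_pattern n k N (g v u)) 0 = L (alternating (2 ^ k) N) 0"
      by (intro iterated_norm_signed_pattern_point)
    \<comment> \<open>One \<kappa> is due to the choice of \<open>N\<close>, the other to replacing
      limits by actual points.\<close>
    then have "norm (h v - h u) \<le> \<rho> * (1 + \<kappa>) + \<kappa> * \<rho>"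
      using approx[OF \<open>v \<in> V\<close> \<open>u \<in> V\<close>] N(2) by (simp add: \<rho>_def)
    then show "case e of (u, v) \<Rightarrow> norm (h u - h v) \<le> \<rho> * (1 + 2 * \<kappa>)"
      by (simp add: uv norm_minus_commute algebra_simps)
  next
    fix u v assume uv: "u \<in> diamond_verts n k" "v \<in> diamond_verts n k"
    then have "separated n k u v"
      using separated_if_admissible[OF assms(2) admissible_Bottom_Top] V unfolding V_def by blast
    then obtain c x i j where sep: "walk n k u v x" "x \<le> 2 * \<bar>c\<bar>" "i < k" "j < k" "i \<noteq> j"
      and partial: "\<forall>\<beta>. \<beta> i \<noteq> \<beta> j \<longrightarrow> (\<exists>s\<le>2 ^ n. sum (cover_diff n \<beta> u v) {..<s} = c \<or>
        sum (cover_diff n \<beta> u v) {s..<2 ^ n} = c)"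
      unfolding separated_def by (elim exE conjE)
    define G where "G = {m :: nat. bit m i \<noteq> bit m j}"
    have "\<rho> * (\<bar>c\<bar> / 2) = real N * \<bar>c\<bar> * (\<phi> / 2)" by (simp add: \<rho>_def)
    also have "\<dots> \<le> L (signed_pattern n k N (g u v)) 0"
    proof (rule iterated_norm_signed_pattern_ge[where G = G])
      show "\<exists>s\<le>2 ^ n. sum (g u v m) {..<s} = c \<or> sum (g u v m) {s..<2 ^ n} = c" if "m \<in> G" for m
        using partial that unfolding G_def g_def by blast
      show "\<phi> / 2 * real K \<le> L (alternating (card (G \<inter> {..<2 ^ k})) K) 0" if "K \<ge> 1" for K
        using \<phi>_le[OF that] alternating_double[of "card (G \<inter> {..<2 ^ k})" K]
          card_bits_differ[OF sep(3-5)] by (simp add: G_def)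
    qed (rule N(1))
    also have "\<dots> \<le> norm (h u - h v) + \<kappa> * \<rho>"
      using approx[of u v] uv by (simp add: V_def)
    finally have "\<rho> * (\<bar>c\<bar> / 2) - \<kappa> * \<rho> \<le> norm (h u - h v)" by simp
    moreover have "\<rho> * (x / 4) \<le> \<rho> * (\<bar>c\<bar> / 2)"
      using sep(2) \<open>\<rho> > 0\<close> by (intro mult_left_mono) auto
    ultimately show "\<exists>x. walk n k u v x \<and> \<rho> * (x / 4 - \<kappa>) \<le> norm (h u - h v)"
      using sep(1) by (intro exI[of _ x]) (simp add: algebra_simps)
  qed
qed

lemma diamond_embedding:
  assumes "\<epsilon> > 0" and "\<not> superreflexive_wrt TYPE('y::banach) TYPE('x::banach)" and "k \<ge> 2"
  shows "\<exists>f :: diamond_vertex \<Rightarrow> 'x.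
    bilipschitz_embedding (diamond_verts n k) (diamond_dist n k) (4 + \<epsilon>) f"
proof -
  define V where "V = diamond_verts n k"
  define steps where "steps u v = (LEAST m. (u, v) \<in> diamond_adj n k ^^ m)" for u v
  have dist: "diamond_dist n k u v = real (steps u v) / 2 ^ n" for u v
    by (simp add: diamond_dist_def steps_def)
  \<comment> \<open>Since \<kappa> is below 1, \<open>(1 + \<kappa>) * (1 + 2 * \<kappa>)\<close> is
    at most \<open>1 + 5 * \<kappa>\<close>; the required inequality then reduces to
    \<open>\<kappa> * (9 + \<epsilon>) \<le> \<epsilon> / 4\<close>.\<close>
  define \<kappa> where "\<kappa> = \<epsilon> / (4 * (9 + \<epsilon>))"
  have \<kappa>: "\<kappa> > 0" "\<kappa> < 1 / 4" "(1 + \<kappa>) * (1 + 2 * \<kappa>) \<le> (4 + \<epsilon>) * (1 / 4 - \<kappa>)"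
  proof -
    show "\<kappa> > 0" "\<kappa> < 1 / 4" using assms(1) by (simp_all add: \<kappa>_def field_simps)
    have "9 + \<epsilon> \<noteq> 0" using assms(1) by simp
    then have "\<kappa> * (9 + \<epsilon>) = \<epsilon> / 4" by (simp add: \<kappa>_def divide_simps)
    moreover have "\<kappa> * \<kappa> \<le> \<kappa> * 1" using \<open>\<kappa> > 0\<close> \<open>\<kappa> < 1 / 4\<close> by (intro mult_left_mono) auto
    ultimately show "(1 + \<kappa>) * (1 + 2 * \<kappa>) \<le> (4 + \<epsilon>) * (1 / 4 - \<kappa>)" by (simp add: algebra_simps)
  qed
  have fr: "finitely_representable TYPE('y) TYPE('x)" and "\<not> reflexive_space TYPE('y)"
    using assms(2) by (auto simp: superreflexive_wrt_def)
  then obtain F :: "('y \<Rightarrow>\<^sub>L real) \<Rightarrow>\<^sub>L real" where F: "F \<notin> range canonical_embedding"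
    unfolding reflexive_space_def by blast
  obtain U :: "'y filter" where "weak_star_ultrafilter U F"
    using ex_ultrafilter_weak_star[of F] unfolding weak_star_ultrafilter_def by metis
  then interpret weak_star_ultrafilter U F .
  obtain h :: "diamond_vertex \<Rightarrow> 'y" and \<rho> where "\<rho> > 0"
    and edge: "\<And>u v. (u, v) \<in> diamond_edges n k \<Longrightarrow> norm (h u - h v) \<le> \<rho> * (1 + 2 * \<kappa>)"
    and pair: "\<And>u v. u \<in> V \<Longrightarrow> v \<in> V \<Longrightarrow> \<exists>x. walk n k u v x \<and> \<rho> * (x / 4 - \<kappa>) \<le> norm (h u - h v)"
    using diamond_embedding_approx[OF F assms(3) \<kappa>(1), of n] unfolding V_def by blast
  have h_bounds: "\<rho> * (1 / 4 - \<kappa>) * real (steps u v) \<le> norm (h u - h v)"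
      "norm (h u - h v) \<le> \<rho> * (1 + 2 * \<kappa>) * real (steps u v)" if uv: "u \<in> V" "v \<in> V" for u v
  proof -
    obtain m where m: "(u, v) \<in> diamond_adj n k ^^ m" "\<rho> * (real m / 4 - \<kappa>) \<le> norm (h u - h v)"
      using pair[OF uv] unfolding walk_def by blast
    have le: "norm (h u - h v) \<le> \<rho> * (1 + 2 * \<kappa>) * real l" if "(u, v) \<in> diamond_adj n k ^^ l" for l u v
      using that
    proof (induction l arbitrary: v)
      case (Suc l)
      then obtain w where w: "(u, w) \<in> diamond_adj n k ^^ l" "(w, v) \<in> diamond_adj n k" by auto
      have "norm (h w - h v) \<le> \<rho> * (1 + 2 * \<kappa>)"
        using w(2) edge[of w v] edge[of v w] by (auto simp: diamond_adj_def norm_minus_commute)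
      then have "norm (h u - h v) \<le> \<rho> * (1 + 2 * \<kappa>) * real l + \<rho> * (1 + 2 * \<kappa>)"
        using Suc.IH[OF w(1)] norm_triangle_ineq[of "h u - h w" "h w - h v"] by simp
      then show ?case by (simp add: algebra_simps)
    qed simp
    show "norm (h u - h v) \<le> \<rho> * (1 + 2 * \<kappa>) * real (steps u v)"
      unfolding steps_def using m(1) by (intro le) (rule LeastI)
    show "\<rho> * (1 / 4 - \<kappa>) * real (steps u v) \<le> norm (h u - h v)"
    \<comment> \<open>For a positive number of steps, \<open>m \<ge> 1\<close> lets the additive
      error \<kappa> be absorbed as a multiple of \<open>m\<close>.\<close>
    proof (cases "steps u v = 0")
      case False
      have "steps u v \<le> m" unfolding steps_def using m(1) by (rule Least_le)
      with False have "(1 / 4 - \<kappa>) * real (steps u v) \<le> (1 / 4 - \<kappa>) * real m" and "m \<ge> 1"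
        using \<kappa>(2) by (auto intro!: mult_left_mono)
      moreover have "\<kappa> * 1 \<le> \<kappa> * real m" using \<kappa>(1) \<open>m \<ge> 1\<close> by (intro mult_left_mono) auto
      ultimately have "(1 / 4 - \<kappa>) * real (steps u v) \<le> real m / 4 - \<kappa>"
        by (simp add: algebra_simps)
      then have "\<rho> * ((1 / 4 - \<kappa>) * real (steps u v)) \<le> \<rho> * (real m / 4 - \<kappa>)"
        using \<open>\<rho> > 0\<close> by (intro mult_left_mono) auto
      with m(2) show ?thesis by (simp add: mult.assoc)
    qed simp
  qed
  have "finite (h ` V)" using finite_diamond_verts by (simp add: V_def)
  with fr \<kappa>(1) obtain T :: "'y \<Rightarrow> 'x" and a b where T: "linear T" "0 < a" "0 < b" "a * b \<le> 1 + \<kappa>"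
    "\<And>y. y \<in> span (h ` V) \<Longrightarrow> norm (T y) \<le> a * norm y \<and> norm y \<le> b * norm (T y)"
    unfolding finitely_representable_def by metis
  \<comment> \<open>The factor \<open>2 ^ n\<close> undoes the normalisation of edge lengths, and
    \<open>b\<close> accounts for the loss in the lower bound under \<open>T\<close>.\<close>
  define r where "r = \<rho> * (1 / 4 - \<kappa>) * 2 ^ n / b"
  have "r > 0" using \<open>\<rho> > 0\<close> \<kappa>(2) T(3) by (simp add: r_def)
  have "r * diamond_dist n k u v \<le> norm (T (h u) - T (h v)) \<and>
      norm (T (h u) - T (h v)) \<le> (4 + \<epsilon>) * r * diamond_dist n k u v" if uv: "u \<in> V" "v \<in> V" for u v
  proof -
    have eq: "T (h u) - T (h v) = T (h u - h v)" by (simp add: linear_diff[OF T(1)])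
    have "h u - h v \<in> span (h ` V)" using uv by (intro span_diff span_base) auto
    note Tuv = T(5)[OF this]
    have "r * diamond_dist n k u v = \<rho> * (1 / 4 - \<kappa>) * real (steps u v) / b"
      by (simp add: r_def dist)
    also have "\<dots> \<le> norm (h u - h v) / b"
      using h_bounds(1)[OF uv] T(3) by (intro divide_right_mono) auto
    also have "\<dots> \<le> norm (T (h u - h v))"
      using Tuv T(3) by (simp add: field_simps)
    finally have lower: "r * diamond_dist n k u v \<le> norm (T (h u) - T (h v))" by (simp add: eq)
    have "b * norm (T (h u - h v)) \<le> b * (a * norm (h u - h v))"
      using Tuv T(3) by (intro mult_left_mono) auto
    also have "\<dots> \<le> (1 + \<kappa>) * norm (h u - h v)"
      using mult_right_mono[OF T(4), of "norm (h u - h v)"] by (simp add: mult_ac)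
    also have "\<dots> \<le> (1 + \<kappa>) * (\<rho> * (1 + 2 * \<kappa>) * real (steps u v))"
      using h_bounds(2)[OF uv] \<kappa>(1) by (intro mult_left_mono) auto
    also have "\<dots> = ((1 + \<kappa>) * (1 + 2 * \<kappa>)) * (\<rho> * real (steps u v))" by (simp only: mult_ac)
    also have "\<dots> \<le> ((4 + \<epsilon>) * (1 / 4 - \<kappa>)) * (\<rho> * real (steps u v))"
      using \<kappa>(3) \<open>\<rho> > 0\<close> by (intro mult_right_mono) auto
    also have "\<dots> = b * ((4 + \<epsilon>) * r * diamond_dist n k u v)"
      using T(3) by (simp add: r_def dist)
    finally show ?thesis using lower T(3) by (simp add: eq)
  qed
  then show ?thesis
    using \<open>r > 0\<close> unfolding bilipschitz_embedding_def V_def by (intro exI[of _ "T \<circ> h"] exI[of _ r]) auto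
qed

theorem theorem1p3:
  fixes \<epsilon> :: real and n k :: nat
  assumes "\<epsilon> > 0"
    and "\<not> superreflexive_wrt TYPE('y::banach) TYPE('x::banach)"
    and "k \<ge> 2"
  shows "\<exists>f :: diamond_vertex \<Rightarrow> 'x.
           bilipschitz_embedding (diamond_verts n k) (diamond_dist n k) (8 + \<epsilon>) f"
  \<comment> \<open>The bound \<open>4 + \<delta>\<close> is taken at
    \<open>\<delta> = 4 + \<epsilon>\<close>.\<close>
  using diamond_embedding[of "4 + \<epsilon>", OF _ assms(2,3)] assms(1) by simp

end
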